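(* In the setting below, the intersection of the image of the map $\partial_3$ with $\operatorname{Span}\{\phi_1,\phi_2,\phi_3,\phi_4\}$ has dimension at most $2$. Consequently, the dimension of $\operatorname{Span}\{\phi_1,\phi_2,\phi_3,\phi_4\}$ modulo the image of $\partial_3$ is at least $2$; that is, one can choose two functions in $\operatorname{Span}\{\phi_1,\phi_2,\phi_3,\phi_4\}$ spanning a $2$-dimensional subspace of the cokernel of $\partial_3$.
   Context: Setting: $A=(a_{ij})$ is a $d\times n$ integer matrix of rank $d$, $n-d=2$, columns in $\{1\}\times\mathbb{Z}^{d-1}$ spanning $\mathbb{Z}^d$; $H_A(\beta')$ is the left ideal of the Weyl algebra generated by $\partial^u-\partial^{u'}$ ($u,u'\in\mathbb{N}^n$, $Au=Au'$) and $\sum_j a_{ij}x_j\partial_j-\beta'_i$; solutions are holomorphic solutions near a generic point. $B=(b_{ji})$ is $n\times2$ with columns $B_1,B_2$ a $\mathbb{Z}$-basis of $\ker_{\mathbb{Z}}(A)$, $b_{11},b_{12}>0$, $b_{21}<0<b_{22}$, $b_{31},b_{32}<0$, $b_{41}>0>b_{42}$, and if rows 2, 4 of $B$ are linearly independent then $\{z\in\mathbb{R}^2:(Bz)_2\ge0,(Bz)_4\ge0\}$ lies in the first quadrant. $\alpha_5,\dots,\alpha_n\in\mathbb{C}\setminus\mathbb{Q}$ with $\alpha_i\notin\mathbb{Q}(\alpha_j:j\ge5,j\ne i)$; $v=B_{1+}+B_{2+}-e_1-e_2-e_4+\sum_{i\ge5}\alpha_ie_i$, $(u_+)_l=\max(u_l,0)$,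 $u_-=u_+-u$; $\beta=A(v-e_3)$. $\partial_3$ is the linear map $\psi\mapsto\partial\psi/\partial x_3$ from the solution space of $H_A(A\cdot v)$ to that of $H_A(\beta)$. $\phi_1=\phi_{v-e_3-B_1-B_2}$, $\phi_2=\phi_{v-e_3-B_2}$, $\phi_3=\phi_{v-e_3}$, $\phi_4=\phi_{v-e_3-B_1}$, where for $u$ with minimum negative support (for all $v'\in\ker_{\mathbb{Z}}A$, $\operatorname{nsupp}(u+v')\subseteq\operatorname{nsupp}(u)$ implies equality; $\operatorname{nsupp}(u)=\{i:u_i\in\mathbb{Z}_{<0}\}$), $\phi_u=\sum_{v'\in N_u}\frac{[u]_{v'_-}}{[v'+u]_{v'_+}}x^{u+v'}$, $N_u=\{v'\in\ker_{\mathbb{Z}}A:\operatorname{nsupp}(u+v')=\operatorname{nsupp}(u)\}$, $[u]_{v'_-}=\prod_{i:v'_i<0}\prod_{j=1}^{-v'_i}(u_i-j+1)$, $[v'+u]_{v'_+}=\prod_{i:v'_i>0}\prod_{j=1}^{v'_i}(u_i+j)$; these are solutions of $H_A(\beta)$. *)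

theory Defs
  imports "HOL-Analysis.Analysis" "HOL-Library.Function_Algebras"
begin

section \<open>Complex vector spaces of functions\<close>

definition cscale :: "complex \<Rightarrow> ('a \<Rightarrow> complex) \<Rightarrow> 'a \<Rightarrow> complex" where
  "cscale c f = (\<lambda>x. c * f x)"

global_interpretation cfun: vector_space "cscale :: complex \<Rightarrow> ('a \<Rightarrow> complex) \<Rightarrow> 'a \<Rightarrow> complex"
  by unfold_locales (auto simp: cscale_def fun_eq_iff algebra_simps)

text \<open>Dimension of the image of \<open>V\<close> in the quotient by the subspace \<open>W\<close>, as the least number
  of elements of \<open>V\<close> that generate \<open>V\<close> modulo \<open>W\<close> (meaningful for finite-dimensional \<open>V\<close>).\<close>

definition dim_mod :: "('a \<Rightarrow> complex) set \<Rightarrow> ('a \<Rightarrow> complex) set \<Rightarrow> nat" where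
  "dim_mod V W = (LEAST k. \<exists>T. finite T \<and> card T = k \<and> T \<subseteq> V \<and> V \<subseteq> cfun.span (T \<union> W))"


section \<open>Holomorphic functions of several variables\<close>

definition mholomorphic_on :: "(complex^'n \<Rightarrow> complex) \<Rightarrow> (complex^'n) set \<Rightarrow> bool"
  (infixl \<open>mholomorphic'_on\<close> 50) where
  "f mholomorphic_on U \<longleftrightarrow>
     (\<forall>x\<in>U. \<exists>f'. (f has_derivative f') (at x) \<and> (\<forall>c h. f' (c *s h) = c * f' h))"

definition pd :: "'n::finite \<Rightarrow> (complex^'n \<Rightarrow> complex) \<Rightarrow> complex^'n \<Rightarrow> complex" where
  "pd j f x = deriv (\<lambda>t. f (x + axis j t)) 0"

text \<open>The monomial \<open>\<partial>\<^sup>u\<close>, with the variables taken in an arbitrary fixed order; the order is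
  immaterial on holomorphic functions.\<close>

definition pd_monom :: "nat^'n \<Rightarrow> (complex^'n \<Rightarrow> complex) \<Rightarrow> complex^'n \<Rightarrow> complex" where
  "pd_monom u = foldr (\<lambda>j P. (pd j ^^ (u $ j)) \<circ> P)
                  (SOME xs. distinct xs \<and> set xs = (UNIV :: 'n set)) id"

text \<open>Analytic continuation of the germ of \<open>g\<close> at \<open>q\<close> to the germ of \<open>f\<close> at \<open>p\<close> along some path.\<close>

definition continues_to ::
  "(complex^'n \<Rightarrow> complex) \<Rightarrow> complex^'n \<Rightarrow> (complex^'n \<Rightarrow> complex) \<Rightarrow> complex^'n \<Rightarrow> bool" where
  "continues_to g q f p \<longleftrightarrow>
     (\<exists>\<gamma> F \<rho>. path \<gamma> \<and> pathstart \<gamma> = q \<and> pathfinish \<gamma> = p \<and>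
        (\<forall>t\<in>{0..1}. \<rho> t > 0 \<and> F t mholomorphic_on ball (\<gamma> t) (\<rho> t)) \<and>
        (\<forall>t\<in>{0..1}. \<exists>\<delta>>0. \<forall>s\<in>{0..1}. \<bar>s - t\<bar> < \<delta> \<longrightarrow>
           (\<forall>\<^sub>F x in nhds (\<gamma> s). F s x = F t x)) \<and>
        (\<forall>\<^sub>F x in nhds q. F (0::real) x = g x) \<and>
        (\<forall>\<^sub>F x in nhds p. F 1 x = f x))"


section \<open>A-hypergeometric systems\<close>

text \<open>The Weyl algebra acts faithfully on holomorphic functions, and its elements are represented
  by the operators through which they act.\<close>

inductive_set weyl :: "((complex^'n \<Rightarrow> complex) \<Rightarrow> complex^'n \<Rightarrow> complex) set" where
  const: "(\<lambda>f x. c * f x) \<in> weyl"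
| var: "(\<lambda>f x. x $ j * f x) \<in> weyl"
| pd: "pd j \<in> weyl"
| add: "P \<in> weyl \<Longrightarrow> Q \<in> weyl \<Longrightarrow> (\<lambda>f x. P f x + Q f x) \<in> weyl"
| mult: "P \<in> weyl \<Longrightarrow> Q \<in> weyl \<Longrightarrow> P \<circ> Q \<in> weyl"

inductive_set hypergeometric_ideal ::
  "int^'n^'d \<Rightarrow> complex^'d \<Rightarrow> ((complex^'n \<Rightarrow> complex) \<Rightarrow> complex^'n \<Rightarrow> complex) set"
  for A :: "int^'n^'d" and \<beta> :: "complex^'d" where
  toric: "A *v (\<chi> j. int (u $ j)) = A *v (\<chi> j. int (u' $ j)) \<Longrightarrow>
    (\<lambda>f x. pd_monom u f x - pd_monom u' f x) \<in> hypergeometric_ideal A \<beta>"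
| euler: "(\<lambda>f x. (\<Sum>j\<in>UNIV. of_int (A $ i $ j) * x $ j * pd j f x) - \<beta> $ i * f x)
    \<in> hypergeometric_ideal A \<beta>"
| add: "P \<in> hypergeometric_ideal A \<beta> \<Longrightarrow> Q \<in> hypergeometric_ideal A \<beta> \<Longrightarrow>
    (\<lambda>f x. P f x + Q f x) \<in> hypergeometric_ideal A \<beta>"
| left_mult: "P \<in> weyl \<Longrightarrow> Q \<in> hypergeometric_ideal A \<beta> \<Longrightarrow> P \<circ> Q \<in> hypergeometric_ideal A \<beta>"

text \<open>Functions on an open set \<open>U\<close> are extended by \<open>0\<close>, so that two solutions on \<open>U\<close> are equal
  iff they agree on \<open>U\<close>.\<close>

definition solutions ::
  "(complex^'n) set \<Rightarrow> int^'n^'d \<Rightarrow> complex^'d \<Rightarrow> (complex^'n \<Rightarrow> complex) set" where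
  "solutions U A \<beta> = {f. f mholomorphic_on U \<and> (\<forall>x. x \<notin> U \<longrightarrow> f x = 0) \<and>
     (\<forall>P\<in>hypergeometric_ideal A \<beta>. \<forall>x\<in>U. P f x = 0)}"

definition pd_map ::
  "(complex^'n) set \<Rightarrow> 'n::finite \<Rightarrow> (complex^'n \<Rightarrow> complex) \<Rightarrow> complex^'n \<Rightarrow> complex" where
  "pd_map U j \<psi> = (\<lambda>x. if x \<in> U then pd j \<psi> x else 0)"


section \<open>The logarithm-free series\<close>

definition cvec :: "int^'n \<Rightarrow> complex^'n" where
  "cvec u = (\<chi> l. of_int (u $ l))"

definition pos_part :: "int^'n \<Rightarrow> int^'n" where
  "pos_part u = (\<chi> l. max (u $ l) 0)"

definition nsupp :: "complex^'n \<Rightarrow> 'n set" where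
  "nsupp u = {i. \<exists>k::int. k < 0 \<and> u $ i = of_int k}"

definition same_nsupp :: "int^'n^'d \<Rightarrow> complex^'n \<Rightarrow> (int^'n) set" where
  "same_nsupp A u = {v'. A *v v' = 0 \<and> nsupp (u + cvec v') = nsupp u}"

definition phi_coeff :: "complex^'n \<Rightarrow> int^'n \<Rightarrow> complex" where
  "phi_coeff u v' =
     (\<Prod>i\<in>{i. v' $ i < 0}. \<Prod>j=1..nat (- (v' $ i)). u $ i - of_nat j + 1) /
     (\<Prod>i\<in>{i. v' $ i > 0}. \<Prod>j=1..nat (v' $ i). u $ i + of_nat j)"

text \<open>The series \<open>\<phi>\<^sub>u\<close> converges near \<open>q\<close> with sum \<open>f\<close>, for some branch \<open>L\<close> of
  \<open>(log x\<^sub>1, \<dots>, log x\<^sub>n)\<close> near \<open>q\<close>. All exponents of \<open>\<phi>\<^sub>u\<close> agree modulo \<open>\<int>\<close>, so another branch only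
  multiplies \<open>f\<close> by a nonzero constant.\<close>

definition phi_sum ::
  "int^'n^'d \<Rightarrow> complex^'n \<Rightarrow> complex^'n \<Rightarrow> (complex^'n \<Rightarrow> complex) \<Rightarrow> bool" where
  "phi_sum A u q f \<longleftrightarrow>
     (\<exists>\<epsilon>>0. \<exists>L :: complex^'n \<Rightarrow> complex^'n.
        (\<forall>j. (\<lambda>x. L x $ j) mholomorphic_on ball q \<epsilon>) \<and>
        (\<forall>x\<in>ball q \<epsilon>. \<forall>j. exp (L x $ j) = x $ j) \<and>
        (\<forall>x\<in>ball q \<epsilon>.
           ((\<lambda>v'. phi_coeff u v' * exp (\<Sum>j\<in>UNIV. (u + cvec v') $ j * L x $ j)) has_sum f x)
             (same_nsupp A u)))"

definition phi_converges :: "int^'n^'d \<Rightarrow> complex^'n \<Rightarrow> complex^'n \<Rightarrow> bool" where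
  "phi_converges A u q \<longleftrightarrow> (\<exists>g. phi_sum A u q g)"

text \<open>\<open>f\<close> is the function \<open>\<phi>\<^sub>u\<close> near \<open>p\<close>: the sum of the series if it converges there, and
  otherwise an analytic continuation of its sum from elsewhere.\<close>

definition is_phi ::
  "int^'n^'d \<Rightarrow> complex^'n \<Rightarrow> complex^'n \<Rightarrow> (complex^'n \<Rightarrow> complex) \<Rightarrow> bool" where
  "is_phi A u p f \<longleftrightarrow>
     (if phi_converges A u p then phi_sum A u p f
      else \<exists>q g. phi_sum A u q g \<and> continues_to g q f p)"


section \<open>Field extensions of the rationals inside the complex numbers\<close>

definition complex_subfield :: "complex set \<Rightarrow> bool" where
  "complex_subfield K \<longleftrightarrow> 1 \<in> K \<and> (\<forall>a\<in>K. \<forall>b\<in>K. a - b \<in> K \<and> a * b \<in> K) \<and> (\<forall>a\<in>K. inverse a \<in> K)"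

definition rat_adjoin :: "complex set \<Rightarrow> complex set" where
  "rat_adjoin S = complex_subfield hull S"

end

theory Submission
  imports Defs "HOL-Complex_Analysis.Conformal_Mappings"
begin

text \<open>
  Let \<open>w\<close> be a linear dependence between the rows \<open>1, \<dots>, 4\<close> of \<open>B\<close>; extended by \<open>0\<close>, it lies in the
  row space of \<open>A\<close>. Write \<open>v = y + M\<close> with \<open>y = \<Sum>\<^sub>i\<^sub>\<ge>\<^sub>5 \<alpha>\<^sub>i e\<^sub>i\<close> and \<open>M\<close> a vector of natural numbers. There
  are monomials \<open>\<partial>\<^bsup>m\<^sub>i\<^esup>\<close> such that every solution \<open>\<psi>\<close> of \<open>H\<^sub>A(A v)\<close> satisfies
  \<open>\<partial>\<^bsup>m\<^sub>i\<^esup> \<partial>\<^sub>3 \<psi> = \<partial>\<^sub>i \<partial>\<^sup>M \<psi>\<close> for \<open>i = 1, \<dots>, 4\<close>, while \<open>\<partial>\<^sup>M \<psi>\<close> satisfies the Euler relations of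
  degree \<open>A y\<close>, where \<open>w \<cdot> y = 0\<close>. Therefore the operator \<open>P\<^sub>w = \<Sum>\<^sub>i w\<^sub>i x\<^sub>i \<partial>\<^bsup>m\<^sub>i\<^esup>\<close> annihilates the image
  of \<open>\<partial>\<^sub>3\<close>. On the series, on the other hand, all terms but one cancel and \<open>P\<^sub>w \<phi>\<^sub>j = w\<^sub>j K\<^sub>j x\<^sup>y\<close> with
  \<open>K\<^sub>j \<noteq> 0\<close>; up to a nonzero factor this survives analytic continuation. The dependences form a space
  of dimension \<open>2\<close>, so evaluating \<open>P\<^sub>w\<close> at \<open>p\<close> yields two independent functionals on the span that
  vanish on the image of \<open>\<partial>\<^sub>3\<close>.
\<close>


section \<open>Separately holomorphic functions\<close>

lemma axis_zero [simp]: "axis k 0 = 0"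
  by (simp add: vec_eq_iff axis_def)

lemma axis_add: "axis k (a + b :: 'a::monoid_add) = axis k a + axis k b"
  by (simp add: vec_eq_iff axis_def)

lemma axis_scaleR: "axis k (c *\<^sub>R a :: 'a::real_vector) = c *\<^sub>R axis k a"
  by (simp add: vec_eq_iff axis_def)

lemma norm_axis [simp]: "norm (axis k a :: 'a::real_normed_vector^'n) = norm a"
proof -
  have "norm (axis k a :: 'a^'n) = L2_set (\<lambda>i. if i = k then norm a else 0) UNIV"
    unfolding norm_vec_def by (rule L2_set_cong) (auto simp: axis_def)
  also have "\<dots> = sqrt (\<Sum>i\<in>UNIV. if i = k then (norm a)\<^sup>2 else 0)"
    unfolding L2_set_def by (intro arg_cong[where f = sqrt] sum.cong) auto
  finally show ?thesis by simp
qed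

lemma bounded_linear_axis: "bounded_linear (axis k :: 'a::real_normed_vector \<Rightarrow> 'a^'n)"
  by (rule bounded_linear_intro[where K = 1]) (simp_all add: axis_add axis_scaleR)

lemma continuous_on_add_axis [continuous_intros]:
  "continuous_on S (\<lambda>t. x + axis k t :: 'a::real_normed_vector^'n)"
  by (intro continuous_intros linear_continuous_on bounded_linear_axis)

lemma add_axis_in_ball:
  fixes x :: "'a::real_normed_vector^'n"
  assumes "x \<in> ball x0 r" "norm t \<le> s"
  shows "x + axis k t \<in> ball x0 (r + s)"
  using assms norm_triangle_ineq[of "x - x0" "axis k t"]
  by (simp add: dist_norm norm_minus_commute[of x0] add_diff_eq diff_add_eq)

lemma eventually_slice:
  fixes x :: "'a::real_normed_vector^'n"
  assumes "\<forall>\<^sub>F y in nhds x. P y"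
  shows "\<forall>\<^sub>F t in nhds 0. P (x + axis k t)"
proof -
  have "((\<lambda>t. x + axis k t) \<longlongrightarrow> x + axis k 0) (at 0)"
    using continuous_on_add_axis[of UNIV x k] unfolding continuous_on_def by blast
  then have "filterlim (\<lambda>t. x + axis k t) (nhds x) (nhds 0)"
    using tendsto_at_iff_tendsto_nhds[of "\<lambda>t. x + axis k t" 0] by simp
  then show ?thesis
    using assms unfolding filterlim_iff by blast
qed

definition sep_holomorphic_on :: "(complex^'n::finite \<Rightarrow> complex) \<Rightarrow> (complex^'n) set \<Rightarrow> bool"
    (infixl \<open>sep'_holomorphic'_on\<close> 50) where
  "f sep_holomorphic_on U \<longleftrightarrow>
     continuous_on U f \<and> (\<forall>x\<in>U. \<forall>k. (\<lambda>t. f (x + axis k t)) field_differentiable at 0)"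

named_theorems sep_holomorphic_intros

lemma mholomorphic_on_imp_sep_holomorphic_on:
  assumes "f mholomorphic_on U"
  shows "f sep_holomorphic_on U"
  unfolding sep_holomorphic_on_def
proof (intro conjI ballI allI)
  show "continuous_on U f"
    using assms unfolding mholomorphic_on_def
    by (intro continuous_at_imp_continuous_on) (blast intro: has_derivative_continuous)
  fix x k assume "x \<in> U"
  then obtain f' where f': "(f has_derivative f') (at x)" and lin: "\<And>c h. f' (c *s h) = c * f' h"
    using assms unfolding mholomorphic_on_def by blast
  have "((\<lambda>t. x + axis k t) has_derivative axis k) (at 0)"
    using has_derivative_add[OF has_derivative_const
        bounded_linear_imp_has_derivative[OF bounded_linear_axis[of k]], of x] by simp
  with f' have "((\<lambda>t. f (x + axis k t)) has_derivative (\<lambda>t. f' (axis k t))) (at 0)"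
    using has_derivative_compose[of "\<lambda>t. x + axis k t" "axis k" 0 UNIV f f'] by simp
  moreover have "(\<lambda>t. f' (axis k t)) = (*) (f' (axis k 1))"
  proof
    fix t :: complex
    have "axis k t = t *s axis k 1"
      by (simp add: vec_eq_iff axis_def)
    then show "f' (axis k t) = f' (axis k 1) * t" using lin[of t "axis k 1"] by (simp only: mult.commute)
  qed
  ultimately have "((\<lambda>t. f (x + axis k t)) has_field_derivative f' (axis k 1)) (at 0)"
    unfolding has_field_derivative_def by simp
  then show "(\<lambda>t. f (x + axis k t)) field_differentiable at 0"
    unfolding field_differentiable_def by blast
qed

lemma sep_holomorphic_on_subset:
  "f sep_holomorphic_on U \<Longrightarrow> V \<subseteq> U \<Longrightarrow> f sep_holomorphic_on V"
  unfolding sep_holomorphic_on_def using continuous_on_subset by blast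

lemma sep_holomorphic_onI_local:
  assumes "\<And>x. x \<in> U \<Longrightarrow> \<exists>V. open V \<and> x \<in> V \<and> f sep_holomorphic_on V"
  shows "f sep_holomorphic_on U"
  unfolding sep_holomorphic_on_def
proof (intro conjI ballI allI)
  show "continuous_on U f"
    using assms unfolding sep_holomorphic_on_def
    by (intro continuous_at_imp_continuous_on) (metis continuous_on_eq_continuous_at)
qed (use assms sep_holomorphic_on_def in blast)

lemma has_field_derivative_slice:
  assumes "f sep_holomorphic_on U" "x + axis k t \<in> U"
  shows "((\<lambda>s. f (x + axis k s)) has_field_derivative pd k f (x + axis k t)) (at t)"
proof -
  have "(\<lambda>s. f (x + axis k t + axis k s)) field_differentiable at 0"
    using assms unfolding sep_holomorphic_on_def by blast
  then have "((\<lambda>s. f (x + axis k t + axis k s)) has_field_derivative pd k f (x + axis k t)) (at 0)"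
    by (simp add: pd_def field_differentiable_derivI)
  then have "((\<lambda>s. (\<lambda>s. f (x + axis k s)) (s + t)) has_field_derivative pd k f (x + axis k t)) (at 0)"
    by (simp add: axis_add add_ac)
  then show ?thesis
    by (subst (asm) DERIV_shift[symmetric]) simp
qed

lemma has_field_derivative_slice_0:
  assumes "f sep_holomorphic_on U" "x \<in> U"
  shows "((\<lambda>s. f (x + axis k s)) has_field_derivative pd k f x) (at 0)"
  using has_field_derivative_slice[of f U x k 0] assms by simp

lemma slice_holomorphic_on:
  assumes "f sep_holomorphic_on U" "\<And>t. t \<in> S \<Longrightarrow> x + axis k t \<in> U"
  shows "(\<lambda>t. f (x + axis k t)) holomorphic_on S"
  unfolding holomorphic_on_def
  using has_field_derivative_slice[OF assms] field_differentiable_at_within field_differentiable_def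
  by blast

lemma pd_eqI: "((\<lambda>t. f (x + axis k t)) has_field_derivative D) (at 0) \<Longrightarrow> pd k f x = D"
  unfolding pd_def by (rule DERIV_imp_deriv)

lemma pd_cong_ev:
  assumes "\<forall>\<^sub>F y in nhds x. f y = g y"
  shows "pd k f x = pd k g x"
  unfolding pd_def by (intro deriv_cong_ev eventually_slice assms refl)

lemma sep_holomorphic_on_cong:
  assumes f: "f sep_holomorphic_on U" and U: "open U" and eq: "\<And>x. x \<in> U \<Longrightarrow> f x = g x"
  shows "g sep_holomorphic_on U"
  unfolding sep_holomorphic_on_def
proof (intro conjI ballI allI)
  show "continuous_on U g"
    using f eq continuous_on_cong[of U U f g] unfolding sep_holomorphic_on_def by simp
  fix x k assume x: "x \<in> U"
  have "\<forall>\<^sub>F y in nhds x. f y = g y"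
    using eventually_nhds_in_open[OF U x] by (rule eventually_mono) (rule eq)
  then have "\<forall>\<^sub>F t in nhds 0. f (x + axis k t) = g (x + axis k t)"
    by (rule eventually_slice)
  from DERIV_cong_ev[OF refl this refl]
  have "((\<lambda>t. g (x + axis k t)) has_field_derivative pd k f x) (at 0)"
    using has_field_derivative_slice_0[OF f x] by blast
  then show "(\<lambda>t. g (x + axis k t)) field_differentiable at 0"
    using field_differentiable_def by blast
qed

lemma sep_holomorphic_on_const [sep_holomorphic_intros]: "(\<lambda>x. c) sep_holomorphic_on U"
  unfolding sep_holomorphic_on_def by auto

lemma sep_holomorphic_on_add [sep_holomorphic_intros]:
  "f sep_holomorphic_on U \<Longrightarrow> g sep_holomorphic_on U \<Longrightarrow> (\<lambda>x. f x + g x) sep_holomorphic_on U"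
  unfolding sep_holomorphic_on_def
  by (auto intro!: continuous_intros field_differentiable_add)

lemma sep_holomorphic_on_diff [sep_holomorphic_intros]:
  "f sep_holomorphic_on U \<Longrightarrow> g sep_holomorphic_on U \<Longrightarrow> (\<lambda>x. f x - g x) sep_holomorphic_on U"
  unfolding sep_holomorphic_on_def
  by (auto intro!: continuous_intros field_differentiable_diff)

lemma sep_holomorphic_on_mult [sep_holomorphic_intros]:
  "f sep_holomorphic_on U \<Longrightarrow> g sep_holomorphic_on U \<Longrightarrow> (\<lambda>x. f x * g x) sep_holomorphic_on U"
  unfolding sep_holomorphic_on_def
  by (auto intro!: continuous_intros field_differentiable_mult)

lemma sep_holomorphic_on_sum [sep_holomorphic_intros]:
  "(\<And>i. i \<in> I \<Longrightarrow> f i sep_holomorphic_on U) \<Longrightarrow> (\<lambda>x. \<Sum>i\<in>I. f i x) sep_holomorphic_on U"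
  by (induction I rule: infinite_finite_induct) (auto intro: sep_holomorphic_intros)

lemma has_field_derivative_slice_coordinate:
  "((\<lambda>t. (x + axis k t) $ j) has_field_derivative (if j = k then 1 else 0)) (at t)"
  by (auto simp: axis_def intro!: derivative_eq_intros)

lemma sep_holomorphic_on_coordinate [sep_holomorphic_intros]: "(\<lambda>x. x $ j) sep_holomorphic_on U"
  unfolding sep_holomorphic_on_def field_differentiable_def
  by (intro conjI ballI allI continuous_intros) (rule exI, rule has_field_derivative_slice_coordinate)

lemma sep_holomorphic_on_exp [sep_holomorphic_intros]:
  assumes "f sep_holomorphic_on U"
  shows "(\<lambda>x. exp (f x)) sep_holomorphic_on U"
  unfolding sep_holomorphic_on_def
proof (intro conjI ballI allI)
  show "continuous_on U (\<lambda>x. exp (f x))"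
    using assms unfolding sep_holomorphic_on_def by (auto intro: continuous_intros)
  show "(\<lambda>t. exp (f (x + axis k t))) field_differentiable at 0" if "x \<in> U" for x k
    using DERIV_chain2[OF DERIV_exp has_field_derivative_slice_0[OF assms that]]
      field_differentiable_def by blast
qed

lemma sep_holomorphic_on_translate:
  assumes "f sep_holomorphic_on U" "\<And>x. x \<in> V \<Longrightarrow> x + a \<in> U"
  shows "(\<lambda>x. f (x + a)) sep_holomorphic_on V"
  unfolding sep_holomorphic_on_def
proof (intro conjI ballI allI)
  show "continuous_on V (\<lambda>x. f (x + a))"
    using assms unfolding sep_holomorphic_on_def
    by (auto intro!: continuous_on_compose2[of U f] continuous_intros)
  show "(\<lambda>t. f (x + axis k t + a)) field_differentiable at 0" if "x \<in> V" for x k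
  proof -
    have "(\<lambda>t. f (x + a + axis k t)) field_differentiable at 0"
      using assms that unfolding sep_holomorphic_on_def by blast
    then show ?thesis by (simp add: add_ac)
  qed
qed

lemma pd_translate: "pd k (\<lambda>x. f (x + a)) x = pd k f (x + a)"
  unfolding pd_def by (simp add: add_ac)

lemma pd_const: "pd k (\<lambda>x. c) x = 0"
  by (rule pd_eqI) auto

lemma pd_coordinate: "pd k (\<lambda>x. x $ j) x = (if j = k then 1 else 0)"
  by (rule pd_eqI) (rule has_field_derivative_slice_coordinate)

lemma pd_add:
  assumes "f sep_holomorphic_on U" "g sep_holomorphic_on U" "x \<in> U"
  shows "pd k (\<lambda>x. f x + g x) x = pd k f x + pd k g x"
  by (intro pd_eqI DERIV_add has_field_derivative_slice_0[OF assms(1,3)]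
      has_field_derivative_slice_0[OF assms(2,3)])

lemma pd_diff:
  assumes "f sep_holomorphic_on U" "g sep_holomorphic_on U" "x \<in> U"
  shows "pd k (\<lambda>x. f x - g x) x = pd k f x - pd k g x"
  by (intro pd_eqI DERIV_diff has_field_derivative_slice_0[OF assms(1,3)]
      has_field_derivative_slice_0[OF assms(2,3)])

lemma pd_mult:
  assumes "f sep_holomorphic_on U" "g sep_holomorphic_on U" "x \<in> U"
  shows "pd k (\<lambda>x. f x * g x) x = pd k f x * g x + f x * pd k g x"
  using DERIV_mult[OF has_field_derivative_slice_0[OF assms(1,3), of k]
      has_field_derivative_slice_0[OF assms(2,3), of k]]
  by (intro pd_eqI) (simp add: mult.commute)

lemma pd_cmult:
  assumes "f sep_holomorphic_on U" "x \<in> U"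
  shows "pd k (\<lambda>x. c * f x) x = c * pd k f x"
  using pd_mult[OF sep_holomorphic_on_const assms] by (simp add: pd_const)

lemma pd_sum:
  assumes "\<And>i. i \<in> I \<Longrightarrow> f i sep_holomorphic_on U" "x \<in> U"
  shows "pd k (\<lambda>x. \<Sum>i\<in>I. f i x) x = (\<Sum>i\<in>I. pd k (f i) x)"
  by (intro pd_eqI DERIV_sum has_field_derivative_slice_0[OF assms])

lemma pd_exp:
  assumes "f sep_holomorphic_on U" "x \<in> U"
  shows "pd k (\<lambda>x. exp (f x)) x = exp (f x) * pd k f x"
  by (rule pd_eqI)
     (use DERIV_chain2[OF DERIV_exp has_field_derivative_slice_0[OF assms, of k]] in simp)


section \<open>Partial derivatives as uniform limits\<close>

lemma norm_higher_deriv_le: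
  assumes "g holomorphic_on S" "cball w s \<subseteq> S" "s > 0" "\<And>z. z \<in> S \<Longrightarrow> norm (g z) \<le> B"
  shows "norm ((deriv ^^ n) g w) \<le> fact n * B / s ^ n"
proof (rule Cauchy_inequality)
  show "g holomorphic_on ball w s"
    using assms(1,2) ball_subset_cball by (meson holomorphic_on_subset order.trans)
  show "continuous_on (cball w s) g"
    using assms(1,2) holomorphic_on_imp_continuous_on holomorphic_on_subset by blast
  show "norm (g z) \<le> B" if "norm (w - z) = s" for z
    using assms(2) that by (intro assms(4)) (auto simp: dist_norm)
qed (fact \<open>s > 0\<close>)

lemma holomorphic_difference_quotient_bound:
  assumes hol: "g holomorphic_on ball a R" and B: "\<And>z. z \<in> ball a R \<Longrightarrow> norm (g z) \<le> B"
    and t: "t \<noteq> 0" "norm t < R / 2"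
  shows "norm ((g (a + t) - g a) / t - deriv g a) \<le> 32 * B / R\<^sup>2 * norm t"
proof -
  have R: "R > 0" using t norm_ge_zero[of t] by linarith
  have "norm ((deriv ^^ 0) g (a + t) - (\<Sum>i\<le>1. (deriv ^^ i) g a * (a + t - a) ^ i / fact i))
      \<le> (32 * B / R\<^sup>2) * norm (a + t - a) ^ Suc 1 / fact 1"
  proof (rule complex_Taylor[where S = "ball a (R / 2)"])
    fix i x assume x: "x \<in> ball a (R / 2)"
    then have "x \<in> ball a R" using R by simp
    then show "((deriv ^^ i) g has_field_derivative (deriv ^^ Suc i) g x) (at x within ball a (R / 2))"
      using holomorphic_derivI[OF holomorphic_higher_deriv[OF hol]] has_field_derivative_at_within
      by simp
  next
    fix x assume x: "x \<in> ball a (R / 2)"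
    have "cball x (R / 4) \<subseteq> ball a R"
    proof
      fix z assume "z \<in> cball x (R / 4)"
      then show "z \<in> ball a R" using x R dist_triangle[of a z x] by simp
    qed
    then have "norm ((deriv ^^ 2) g x) \<le> fact 2 * B / (R / 4) ^ 2"
      using R by (intro norm_higher_deriv_le[OF hol _ _ B]) auto
    then show "norm ((deriv ^^ Suc 1) g x) \<le> 32 * B / R\<^sup>2"
      by (simp add: numeral_2_eq_2 power_divide)
  qed (use R t in \<open>auto simp: dist_norm\<close>)
  then have "norm (g (a + t) - g a - deriv g a * t) \<le> 32 * B / R\<^sup>2 * (norm t)\<^sup>2"
    by (simp add: numeral_2_eq_2 diff_diff_eq)
  moreover have "(g (a + t) - g a) / t - deriv g a = (g (a + t) - g a - deriv g a * t) / t"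
    using t by (simp add: field_simps)
  ultimately show ?thesis
    using t by (simp add: norm_divide field_simps power2_eq_square)
qed

lemma norm_pd_le:
  assumes f: "f sep_holomorphic_on U" and U: "cball x s \<subseteq> U" "s > 0"
    and B: "\<And>y. y \<in> U \<Longrightarrow> norm (f y) \<le> B"
  shows "norm (pd k f x) \<le> B / s"
proof -
  have slice: "x + axis k t \<in> U" if "t \<in> cball 0 s" for t
    using that U(1) by (auto simp: subset_iff dist_norm)
  have "norm ((deriv ^^ 1) (\<lambda>t. f (x + axis k t)) 0) \<le> fact 1 * B / s ^ 1"
    by (rule norm_higher_deriv_le[OF slice_holomorphic_on[OF f slice] order.refl U(2) B[OF slice]])
  then show ?thesis by (simp add: pd_def)
qed

definition difference_quotient :: "'n::finite \<Rightarrow> (complex^'n \<Rightarrow> complex) \<Rightarrow> complex \<Rightarrow> complex^'n \<Rightarrow> complex"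
  where "difference_quotient k f t x = (f (x + axis k t) - f x) / t"

lemma difference_quotient_tendsto_pd:
  assumes "f sep_holomorphic_on U" "x \<in> U"
  shows "((\<lambda>t. difference_quotient k f t x) \<longlongrightarrow> pd k f x) (at 0)"
  using has_field_derivative_slice_0[OF assms, of k] by (simp add: difference_quotient_def DERIV_def)

lemma sep_holomorphic_on_difference_quotient:
  assumes f: "f sep_holomorphic_on U" and V: "\<And>y. y \<in> V \<Longrightarrow> y \<in> U \<and> y + axis k t \<in> U"
  shows "difference_quotient k f t sep_holomorphic_on V"
proof -
  have "(\<lambda>x. inverse t * (f (x + axis k t) - f x)) sep_holomorphic_on V"
    using V by (intro sep_holomorphic_intros sep_holomorphic_on_translate[OF f]
        sep_holomorphic_on_subset[OF f]) auto
  then show ?thesis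
    by (simp add: difference_quotient_def[abs_def] divide_inverse mult.commute)
qed

lemma pd_difference_quotient:
  assumes f: "f sep_holomorphic_on U" and x: "x \<in> U" "x + axis k t \<in> U"
  shows "pd j (difference_quotient k f t) x = difference_quotient k (pd j f) t x"
proof -
  have translate: "(\<lambda>x. f (x + axis k t)) sep_holomorphic_on {x}"
    and f': "f sep_holomorphic_on {x}"
    using x by (auto intro: sep_holomorphic_on_translate[OF f] sep_holomorphic_on_subset[OF f])
  have "pd j (\<lambda>x. inverse t * (f (x + axis k t) - f x)) x
      = inverse t * (pd j (\<lambda>x. f (x + axis k t)) x - pd j f x)"
    using pd_cmult[OF sep_holomorphic_on_diff[OF translate f']] pd_diff[OF translate f'] by simp
  then show ?thesis
    by (simp add: pd_translate difference_quotient_def[abs_def] divide_inverse mult.commute)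
qed

lemma difference_quotient_minus_pd_bound:
  assumes f: "f sep_holomorphic_on cball a (2 * \<rho>)" and B: "\<And>x. x \<in> cball a (2 * \<rho>) \<Longrightarrow> norm (f x) \<le> B"
    and x: "x \<in> ball a \<rho>" and t: "t \<noteq> 0" "norm t < \<rho> / 2"
  shows "norm (difference_quotient k f t x - pd k f x) \<le> 32 * B / \<rho>\<^sup>2 * norm t"
proof -
  have slice: "x + axis k s \<in> cball a (2 * \<rho>)" if "s \<in> ball 0 \<rho>" for s
    using add_axis_in_ball[OF x, of s \<rho> k] that by simp
  have "(\<lambda>s. f (x + axis k s)) holomorphic_on ball 0 \<rho>"
    by (rule slice_holomorphic_on[OF f slice])
  from holomorphic_difference_quotient_bound[OF this B[OF slice] t] show ?thesis
    by (simp add: pd_def difference_quotient_def)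
qed

lemma uniform_limit_difference_quotient:
  assumes f: "f sep_holomorphic_on U" and U: "open U" "a \<in> U"
  obtains \<rho> where "\<rho> > 0" "ball a (2 * \<rho>) \<subseteq> U"
    "uniform_limit (ball a \<rho>) (difference_quotient k f) (pd k f) (at 0)"
proof -
  obtain e where e: "e > 0" "cball a e \<subseteq> U"
    using U open_contains_cball by metis
  define \<rho> where "\<rho> = e / 2"
  have \<rho>: "\<rho> > 0" "cball a (2 * \<rho>) \<subseteq> U" using e by (auto simp: \<rho>_def)
  note f' = sep_holomorphic_on_subset[OF f \<rho>(2)]
  have "compact (f ` cball a (2 * \<rho>))"
    using f' unfolding sep_holomorphic_on_def by (intro compact_continuous_image compact_cball) blast
  then obtain B where B: "\<And>x. x \<in> cball a (2 * \<rho>) \<Longrightarrow> norm (f x) \<le> B"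
    by (meson bounded_iff compact_imp_bounded imageI)
  have "uniform_limit (ball a \<rho>) (difference_quotient k f) (pd k f) (at 0)"
  proof (rule uniform_limitI)
    fix \<epsilon> :: real assume "\<epsilon> > 0"
    have "((\<lambda>t::complex. 32 * B / \<rho>\<^sup>2 * norm t) \<longlongrightarrow> 32 * B / \<rho>\<^sup>2 * norm (0::complex)) (at 0)"
      by (intro tendsto_intros)
    then have "\<forall>\<^sub>F t::complex in at 0. 32 * B / \<rho>\<^sup>2 * norm t < \<epsilon>"
      using \<open>\<epsilon> > 0\<close> by (simp add: order_tendsto_iff)
    moreover have "\<forall>\<^sub>F t::complex in at 0. t \<noteq> 0 \<and> norm t < \<rho> / 2"
      unfolding eventually_at using \<rho>(1) by (intro exI[of _ "\<rho> / 2"]) auto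
    ultimately show "\<forall>\<^sub>F t in at 0. \<forall>x\<in>ball a \<rho>. dist (difference_quotient k f t x) (pd k f x) < \<epsilon>"
    proof eventually_elim
      case (elim t)
      then show ?case
        unfolding dist_norm
        by (intro ballI le_less_trans[OF difference_quotient_minus_pd_bound[OF f' B]]) simp_all
    qed
  qed
  moreover have "ball a (2 * \<rho>) \<subseteq> U"
    using ball_subset_cball \<rho>(2) by (rule order.trans)
  ultimately show thesis
    using that \<rho>(1) by blast
qed

lemma slice_uniform_limit:
  fixes g :: "'i \<Rightarrow> complex^'n::finite \<Rightarrow> complex"
  assumes lim: "uniform_limit V g G F" and F: "F \<noteq> bot" and V: "open V" "x \<in> V"
    and g: "\<forall>\<^sub>F i in F. g i sep_holomorphic_on V"
  shows "(\<lambda>t. G (x + axis k t)) field_differentiable at 0"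
    and "((\<lambda>i. pd k (g i) x) \<longlongrightarrow> pd k G x) F"
proof -
  obtain r where r: "r > 0" "cball x r \<subseteq> V" using V open_contains_cball by metis
  have slice: "x + axis k t \<in> V" if "t \<in> cball 0 r" for t
    using that r(2) by (auto simp: subset_iff dist_norm)
  have limit: "uniform_limit (cball 0 r) (\<lambda>i t. g i (x + axis k t)) (\<lambda>t. G (x + axis k t)) F"
    using lim slice unfolding uniform_limit_iff by (smt (verit, best) eventually_mono)
  have slices: "\<forall>\<^sub>F i in F. continuous_on (cball 0 r) (\<lambda>t. g i (x + axis k t)) \<and>
     (\<forall>w\<in>ball 0 r. ((\<lambda>t. g i (x + axis k t)) has_field_derivative pd k (g i) (x + axis k w)) (at w))"
    using g
  proof (eventually_elim, intro conjI ballI)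
    fix i assume gi: "g i sep_holomorphic_on V"
    show "continuous_on (cball 0 r) (\<lambda>t. g i (x + axis k t))"
      using slice_holomorphic_on[OF gi slice] by (rule holomorphic_on_imp_continuous_on)
    show "((\<lambda>t. g i (x + axis k t)) has_field_derivative pd k (g i) (x + axis k w)) (at w)"
      if "w \<in> ball 0 r" for w
      using that slice by (intro has_field_derivative_slice[OF gi]) auto
  qed
  obtain G' where G': "\<And>w. w \<in> ball 0 r \<Longrightarrow>
      ((\<lambda>t. G (x + axis k t)) has_field_derivative G' w) (at w) \<and>
      ((\<lambda>i. pd k (g i) (x + axis k w)) \<longlongrightarrow> G' w) F"
    using has_complex_derivative_uniform_limit[OF slices limit F r(1)] by auto
  from G'[of 0] r(1) have deriv: "((\<lambda>t. G (x + axis k t)) has_field_derivative G' 0) (at 0)"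
    "((\<lambda>i. pd k (g i) x) \<longlongrightarrow> G' 0) F"
    by auto
  from deriv(1) show "(\<lambda>t. G (x + axis k t)) field_differentiable at 0"
    unfolding field_differentiable_def by (rule exI)
  show "((\<lambda>i. pd k (g i) x) \<longlongrightarrow> pd k G x) F"
    using deriv(2) pd_eqI[OF deriv(1)] by simp
qed

lemma sep_holomorphic_on_uniform_limit:
  assumes "uniform_limit V g G F" "F \<noteq> bot" "open V" "\<forall>\<^sub>F i in F. g i sep_holomorphic_on V"
  shows "G sep_holomorphic_on V"
  unfolding sep_holomorphic_on_def
proof (intro conjI ballI allI)
  show "continuous_on V G"
    using assms by (intro uniform_limit_theorem[OF _ assms(1,2)])
      (auto simp: sep_holomorphic_on_def elim: eventually_mono)
qed (rule slice_uniform_limit(1)[OF assms(1-3) _ assms(4)])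

lemma eventually_sep_holomorphic_on_difference_quotient:
  assumes f: "f sep_holomorphic_on U" and \<rho>: "\<rho> > 0" "ball a (2 * \<rho>) \<subseteq> U"
  shows "\<forall>\<^sub>F t in at 0. difference_quotient k f t sep_holomorphic_on ball a \<rho>"
proof -
  have "\<forall>\<^sub>F t::complex in at 0. norm t < \<rho>"
    unfolding eventually_at using \<rho>(1) by (intro exI[of _ \<rho>]) auto
  then show ?thesis
  proof eventually_elim
    case (elim t)
    show ?case
    proof (rule sep_holomorphic_on_difference_quotient[OF f])
      show "y \<in> U \<and> y + axis k t \<in> U" if "y \<in> ball a \<rho>" for y
        using that add_axis_in_ball[OF that, of t \<rho> k] elim \<rho> by (auto simp: subset_iff)
    qed
  qed
qed

lemma sep_holomorphic_on_pd:
  assumes f: "f sep_holomorphic_on U" and U: "open U"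
  shows "pd k f sep_holomorphic_on U"
proof (rule sep_holomorphic_onI_local)
  fix a assume a: "a \<in> U"
  obtain \<rho> where \<rho>: "\<rho> > 0" "ball a (2 * \<rho>) \<subseteq> U"
    and lim: "uniform_limit (ball a \<rho>) (difference_quotient k f) (pd k f) (at 0)"
    by (rule uniform_limit_difference_quotient[OF f U a])
  have "pd k f sep_holomorphic_on ball a \<rho>"
    by (rule sep_holomorphic_on_uniform_limit[OF lim _ open_ball
          eventually_sep_holomorphic_on_difference_quotient[OF f \<rho>]]) simp
  then show "\<exists>V. open V \<and> a \<in> V \<and> pd k f sep_holomorphic_on V"
    using \<rho>(1) by (intro exI[of _ "ball a \<rho>"]) auto
qed

text \<open>Both mixed derivatives are the limit of the difference quotients of \<open>pd k f\<close>, which are the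
  \<open>k\<close>-th derivatives of the uniformly convergent difference quotients of \<open>f\<close>.\<close>

lemma pd_commute:
  assumes f: "f sep_holomorphic_on U" and U: "open U" and x: "x \<in> U"
  shows "pd j (pd k f) x = pd k (pd j f) x"
proof -
  obtain \<rho> where \<rho>: "\<rho> > 0" "ball x (2 * \<rho>) \<subseteq> U"
    and lim: "uniform_limit (ball x \<rho>) (difference_quotient j f) (pd j f) (at 0)"
    by (rule uniform_limit_difference_quotient[OF f U x])
  have "((\<lambda>t. pd k (difference_quotient j f t) x) \<longlongrightarrow> pd k (pd j f) x) (at 0)"
    using \<rho>(1) by (intro slice_uniform_limit(2)[OF lim _ open_ball _
          eventually_sep_holomorphic_on_difference_quotient[OF f \<rho>]]) auto
  moreover have "\<forall>\<^sub>F t in at 0. pd k (difference_quotient j f t) x = difference_quotient j (pd k f) t x"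
  proof -
    have "\<forall>\<^sub>F t in nhds 0. x + axis j t \<in> U"
      using eventually_nhds_in_open[OF U x] by (rule eventually_slice)
    then show ?thesis
      unfolding eventually_at_filter
      by (rule eventually_mono) (auto intro: pd_difference_quotient[OF f x])
  qed
  ultimately have "((\<lambda>t. difference_quotient j (pd k f) t x) \<longlongrightarrow> pd k (pd j f) x) (at 0)"
    by (rule Lim_transform_eventually)
  then show ?thesis
    using tendsto_unique[OF _ difference_quotient_tendsto_pd[OF sep_holomorphic_on_pd[OF f U] x]] by simp
qed


section \<open>Operators of the Weyl algebra\<close>

lemma weyl_cong_ev:
  assumes "P \<in> weyl" "\<forall>\<^sub>F y in nhds x. f y = g y"
  shows "\<forall>\<^sub>F y in nhds x. P f y = P g y"
  using assms
proof (induction arbitrary: f g rule: weyl.induct)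
  case (pd j)
  then have "\<forall>\<^sub>F y in nhds x. \<forall>\<^sub>F z in nhds y. f z = g z"
    by (simp add: eventually_eventually)
  then show ?case
    by (rule eventually_mono) (rule pd_cong_ev)
next
  case (add P Q)
  show ?case
    using add.IH(1)[OF add.prems] add.IH(2)[OF add.prems] by eventually_elim simp
qed (auto elim: eventually_mono)

lemma weyl_cong:
  assumes "P \<in> weyl" "open U" "\<And>y. y \<in> U \<Longrightarrow> f y = g y" "x \<in> U"
  shows "P f x = P g x"
proof -
  have "\<forall>\<^sub>F y in nhds x. f y = g y"
    using assms unfolding eventually_nhds by blast
  then show ?thesis
    using weyl_cong_ev[OF assms(1)] eventually_nhds_x_imp_x by blast
qed

lemma sep_holomorphic_on_weyl:
  assumes "P \<in> weyl" "f sep_holomorphic_on U" "open U"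
  shows "P f sep_holomorphic_on U"
  using assms
  by (induction arbitrary: f rule: weyl.induct) (auto intro: sep_holomorphic_intros sep_holomorphic_on_pd)

lemma weyl_linear_combination:
  assumes "P \<in> weyl" "f sep_holomorphic_on U" "g sep_holomorphic_on U" "open U" "x \<in> U"
  shows "P (\<lambda>x. a * f x + b * g x) x = a * P f x + b * P g x"
  using assms
proof (induction arbitrary: f g x rule: weyl.induct)
  case (pd j)
  then show ?case
    by (simp add: pd_add[of _ U] pd_cmult[of _ U] sep_holomorphic_intros)
next
  case (mult P Q)
  have "(P \<circ> Q) (\<lambda>x. a * f x + b * g x) x = P (\<lambda>x. a * Q f x + b * Q g x) x"
    unfolding o_def
    by (rule weyl_cong[OF mult.hyps(1) \<open>open U\<close> mult.IH(2)[OF mult.prems(1-3)] \<open>x \<in> U\<close>])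
  also have "\<dots> = a * P (Q f) x + b * P (Q g) x"
    by (intro mult.IH(1) sep_holomorphic_on_weyl[OF mult.hyps(2)] mult.prems)
  finally show ?case by simp
qed (auto simp: algebra_simps)

lemma subspace_weyl_kernel_at:
  assumes "P \<in> weyl" "open U" "p \<in> U"
  shows "cfun.subspace {f. f sep_holomorphic_on U \<and> P f p = 0}"
proof (rule cfun.subspaceI)
  note lincomb = weyl_linear_combination[OF assms(1) _ _ assms(2,3)]
  show "0 \<in> {f. f sep_holomorphic_on U \<and> P f p = 0}"
    using lincomb[of "\<lambda>x. 0" "\<lambda>x. 0" 0 0] by (simp add: zero_fun_def sep_holomorphic_intros)
  show "f + g \<in> {f. f sep_holomorphic_on U \<and> P f p = 0}"
    if "f \<in> {f. f sep_holomorphic_on U \<and> P f p = 0}" "g \<in> {f. f sep_holomorphic_on U \<and> P f p = 0}" for f g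
    using that lincomb[of f g 1 1] by (simp add: plus_fun_def sep_holomorphic_intros)
  show "cscale c f \<in> {f. f sep_holomorphic_on U \<and> P f p = 0}"
    if "f \<in> {f. f sep_holomorphic_on U \<and> P f p = 0}" for c f
    using that lincomb[of f f c 0] by (simp add: cscale_def sep_holomorphic_intros)
qed

lemma weyl_id: "id \<in> weyl"
  using weyl.const[of 1] by (simp add: id_def)

lemma weyl_sum:
  assumes "\<And>i. i \<in> I \<Longrightarrow> P i \<in> weyl"
  shows "(\<lambda>f x. \<Sum>i\<in>I. P i f x) \<in> weyl"
  using assms
proof (induction I rule: infinite_finite_induct)
  case (insert i I)
  then show ?case
    using weyl.add[of "P i" "\<lambda>f x. \<Sum>i\<in>I. P i f x"] by simp
qed (use weyl.const[of 0] in simp_all)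

lemma weyl_cmult: "P \<in> weyl \<Longrightarrow> (\<lambda>f x. c * P f x) \<in> weyl"
  using weyl.mult[OF weyl.const[of c], of P] by (simp add: o_def)

lemma weyl_coordinate_mult: "P \<in> weyl \<Longrightarrow> (\<lambda>f x. x $ j * P f x) \<in> weyl"
  using weyl.mult[OF weyl.var[of j], of P] by (simp add: o_def)

lemma weyl_funpow: "P \<in> weyl \<Longrightarrow> P ^^ n \<in> weyl"
  by (induction n) (simp_all only: funpow.simps weyl_id weyl.mult)

definition pd_list :: "'n::finite list \<Rightarrow> nat^'n \<Rightarrow> (complex^'n \<Rightarrow> complex) \<Rightarrow> complex^'n \<Rightarrow> complex" where
  "pd_list ks u = foldr (\<lambda>k P. (pd k ^^ (u $ k)) \<circ> P) ks id"

lemma pd_list_Nil [simp]: "pd_list [] u = id"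
  and pd_list_Cons [simp]: "pd_list (k # ks) u = (pd k ^^ (u $ k)) \<circ> pd_list ks u"
  by (simp_all add: pd_list_def)

lemma pd_monom_eq_pd_list:
  obtains ks where "distinct ks" "set ks = (UNIV :: 'n::finite set)"
    "\<And>u :: nat^'n. pd_monom u = pd_list ks u"
proof -
  have "\<exists>ks. distinct ks \<and> set ks = (UNIV :: 'n::finite set)"
    using finite_distinct_list[of "UNIV :: 'n set"] by auto
  from someI_ex[OF this] show thesis
    using that unfolding pd_monom_def pd_list_def by blast
qed

lemma weyl_pd_list: "pd_list ks u \<in> weyl"
  by (induction ks) (simp_all only: pd_list_Nil pd_list_Cons weyl_id weyl.mult weyl_funpow weyl.pd)

lemma weyl_pd_monom: "pd_monom u \<in> weyl"
  by (metis pd_monom_eq_pd_list weyl_pd_list)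

lemma pd_funpow_commute:
  assumes "f sep_holomorphic_on U" "open U" "x \<in> U"
  shows "pd j ((pd k ^^ n) f) x = (pd k ^^ n) (pd j f) x"
  using assms
proof (induction n arbitrary: x)
  case (Suc n)
  have "pd j ((pd k ^^ Suc n) f) x = pd k (pd j ((pd k ^^ n) f)) x"
    using pd_commute[OF sep_holomorphic_on_weyl[OF weyl_funpow[OF weyl.pd] Suc.prems(1,2)] Suc.prems(2,3)]
    by simp
  also have "\<dots> = pd k ((pd k ^^ n) (pd j f)) x"
    using Suc by (intro weyl_cong[OF weyl.pd, of U]) auto
  finally show ?case by simp
qed simp

lemma pd_list_commute:
  assumes "f sep_holomorphic_on U" "open U" "x \<in> U"
  shows "pd j (pd_list ks u f) x = pd_list ks u (pd j f) x"
  using assms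
proof (induction ks arbitrary: x)
  case (Cons k ks)
  have "pd j (pd_list (k # ks) u f) x = (pd k ^^ (u $ k)) (pd j (pd_list ks u f)) x"
    using pd_funpow_commute[OF sep_holomorphic_on_weyl[OF weyl_pd_list Cons.prems(1,2)] Cons.prems(2,3)]
    by simp
  also have "\<dots> = (pd k ^^ (u $ k)) (pd_list ks u (pd j f)) x"
    using Cons by (intro weyl_cong[OF weyl_funpow[OF weyl.pd], of U]) auto
  finally show ?case by simp
qed simp

lemma pd_list_add_axis:
  assumes f: "f sep_holomorphic_on U" and U: "open U" and "x \<in> U" "distinct ks"
  shows "pd_list ks (u + axis j 1) f x
    = (if j \<in> set ks then pd j (pd_list ks u f) x else pd_list ks u f x)"
  using \<open>x \<in> U\<close> \<open>distinct ks\<close>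
proof (induction ks arbitrary: x)
  case (Cons k ks)
  note cong = weyl_cong[OF weyl_funpow[OF weyl.pd] U _ \<open>x \<in> U\<close>]
  show ?case
  proof (cases "k = j")
    case True
    then have "pd_list ks (u + axis j 1) f y = pd_list ks u f y" if "y \<in> U" for y
      using Cons that by simp
    then have "(pd j ^^ Suc (u $ j)) (pd_list ks (u + axis j 1) f) x
        = (pd j ^^ Suc (u $ j)) (pd_list ks u f) x"
      by (rule cong)
    with True show ?thesis by (simp add: axis_def)
  next
    case False
    define g where "g = (if j \<in> set ks then pd j (pd_list ks u f) else pd_list ks u f)"
    have "pd_list (k # ks) (u + axis j 1) f x = (pd k ^^ (u $ k)) (pd_list ks (u + axis j 1) f) x"
      using False by (simp add: axis_def)
    also have "\<dots> = (pd k ^^ (u $ k)) g x"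
      using Cons by (intro cong) (auto simp: g_def)
    also have "\<dots> = (if j \<in> set ks then pd j ((pd k ^^ (u $ k)) (pd_list ks u f)) x
        else (pd k ^^ (u $ k)) (pd_list ks u f) x)"
      using pd_funpow_commute[OF sep_holomorphic_on_weyl[OF weyl_pd_list f U] U \<open>x \<in> U\<close>]
      by (simp add: g_def)
    finally show ?thesis using False by simp
  qed
qed simp

lemma pd_monom_zero: "pd_monom 0 f = f"
proof -
  have "pd_list ks 0 f = f" for ks :: "'a list"
    by (induction ks) auto
  then show ?thesis
    using pd_monom_eq_pd_list by metis
qed

lemma pd_monom_add_axis:
  assumes "f sep_holomorphic_on U" "open U" "x \<in> U"
  shows "pd_monom (u + axis j 1) f x = pd j (pd_monom u f) x"
  using pd_monom_eq_pd_list pd_list_add_axis[OF assms] by (metis UNIV_I)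

lemma pd_monom_commute:
  assumes "f sep_holomorphic_on U" "open U" "x \<in> U"
  shows "pd j (pd_monom u f) x = pd_monom u (pd j f) x"
  using pd_monom_eq_pd_list pd_list_commute[OF assms] by metis

lemma nat_vec_induct [case_names zero add_axis]:
  fixes u :: "nat^'n::finite"
  assumes "P 0" "\<And>u j. P u \<Longrightarrow> P (u + axis j 1)"
  shows "P u"
proof (induction "\<Sum>j\<in>UNIV. u $ j" arbitrary: u)
  case 0
  then have "u = 0" by (simp add: vec_eq_iff)
  with assms(1) show ?case by simp
next
  case (Suc n)
  then obtain j where j: "u $ j > 0"
    by (metis gr0I sum.neutral zero_less_Suc less_irrefl)
  define w where "w = u - axis j 1"
  have u: "u = w + axis j 1"
    using j by (auto simp: w_def vec_eq_iff axis_def)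
  have "(\<Sum>i\<in>UNIV. u $ i) = (\<Sum>i\<in>UNIV. w $ i) + 1"
    by (simp add: u sum.distrib axis_def)
  then have "P w" using Suc by simp
  then show ?case using assms(2) u by metis
qed

definition euler_op :: "complex^'n::finite \<Rightarrow> (complex^'n \<Rightarrow> complex) \<Rightarrow> complex^'n \<Rightarrow> complex" where
  "euler_op c f x = (\<Sum>k\<in>UNIV. c $ k * (x $ k * pd k f x))"

lemma weyl_euler_op: "euler_op c \<in> weyl"
  unfolding euler_op_def[abs_def] by (intro weyl_sum weyl_cmult weyl_coordinate_mult weyl.pd)

lemma pd_euler_op:
  assumes f: "f sep_holomorphic_on U" and U: "open U" and x: "x \<in> U"
  shows "pd j (euler_op c f) x = euler_op c (pd j f) x + c $ j * pd j f x"
proof -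
  have pd_f: "pd k f sep_holomorphic_on U" for k by (rule sep_holomorphic_on_pd[OF f U])
  have term_hol: "(\<lambda>x. x $ k * pd k f x) sep_holomorphic_on U" for k
    by (intro sep_holomorphic_intros pd_f)
  have "pd j (\<lambda>x. c $ k * (x $ k * pd k f x)) x
      = c $ k * (x $ k * pd k (pd j f) x) + (if k = j then c $ j * pd j f x else 0)" for k
    by (simp add: pd_cmult[OF term_hol x] pd_mult[OF sep_holomorphic_on_coordinate pd_f x]
        pd_coordinate pd_commute[OF f U x, of j] distrib_left)
  then have "pd j (\<lambda>x. \<Sum>k\<in>UNIV. c $ k * (x $ k * pd k f x)) x
      = (\<Sum>k\<in>UNIV. c $ k * (x $ k * pd k (pd j f) x)) + c $ j * pd j f x"
    using pd_sum[of UNIV "\<lambda>k x. c $ k * (x $ k * pd k f x)" U x j] term_hol x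
    by (simp add: sep_holomorphic_intros sum.distrib)
  then show ?thesis
    by (simp add: euler_op_def[abs_def])
qed

lemma euler_op_pd_monom:
  assumes f: "f sep_holomorphic_on U" and U: "open U"
    and eigen: "\<And>x. x \<in> U \<Longrightarrow> euler_op c f x = s * f x" and "x \<in> U"
  shows "euler_op c (pd_monom u f) x = (s - (\<Sum>k\<in>UNIV. c $ k * of_nat (u $ k))) * pd_monom u f x"
  using \<open>x \<in> U\<close>
proof (induction u arbitrary: x rule: nat_vec_induct)
  case zero
  then show ?case using eigen by (simp add: pd_monom_zero)
next
  case (add_axis u j)
  define s' where "s' = s - (\<Sum>k\<in>UNIV. c $ k * of_nat (u $ k))"
  have hol: "pd_monom u f sep_holomorphic_on U"
    by (rule sep_holomorphic_on_weyl[OF weyl_pd_monom f U])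
  have "euler_op c (pd j (pd_monom u f)) x + c $ j * pd j (pd_monom u f) x
      = pd j (euler_op c (pd_monom u f)) x"
    by (simp add: pd_euler_op[OF hol U add_axis.prems])
  also have "\<dots> = pd j (\<lambda>x. s' * pd_monom u f x) x"
    using add_axis.IH by (intro weyl_cong[OF weyl.pd U _ add_axis.prems]) (simp add: s'_def)
  also have "\<dots> = s' * pd j (pd_monom u f) x"
    by (rule pd_cmult[OF hol add_axis.prems])
  finally have "euler_op c (pd j (pd_monom u f)) x = (s' - c $ j) * pd j (pd_monom u f) x"
    by (simp add: algebra_simps)
  moreover have "euler_op c (pd_monom (u + axis j 1) f) x = euler_op c (pd j (pd_monom u f)) x"
    using pd_monom_add_axis[OF f U] by (rule weyl_cong[OF weyl_euler_op U _ add_axis.prems])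
  moreover have "(\<Sum>k\<in>UNIV. c $ k * of_nat ((u + axis j 1) $ k)) = (\<Sum>k\<in>UNIV. c $ k * of_nat (u $ k)) + c $ j"
    by (simp add: distrib_left sum.distrib axis_def if_distrib[of of_nat] if_distrib[of "(*) _"] cong: if_cong)
  ultimately show ?case
    by (simp only: s'_def pd_monom_add_axis[OF f U add_axis.prems] diff_diff_eq)
qed


section \<open>Local constancy and analytic continuation\<close>

definition polydisc :: "complex^'n \<Rightarrow> real \<Rightarrow> (complex^'n) set" where
  "polydisc a \<rho> = {x. \<forall>k. dist (x $ k) (a $ k) < \<rho>}"

lemma centre_in_polydisc: "\<rho> > 0 \<Longrightarrow> a \<in> polydisc a \<rho>"
  by (simp add: polydisc_def)

lemma open_polydisc: "open (polydisc (a :: complex^'n::finite) \<rho>)"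
proof -
  have "polydisc a \<rho> = (\<Inter>k. {x. dist (x $ k) (a $ k) < \<rho>})"
    by (auto simp: polydisc_def)
  then show ?thesis
    by (auto intro!: open_INT open_Collect_less continuous_intros)
qed

lemma open_contains_polydisc:
  assumes "open U" "a \<in> U"
  obtains \<rho> where "\<rho> > 0" "polydisc (a :: complex^'n::finite) \<rho> \<subseteq> U"
proof -
  obtain e where e: "e > 0" "ball a e \<subseteq> U" using assms open_contains_ball by metis
  have "polydisc a (e / CARD('n)) \<subseteq> ball a e"
  proof
    fix x assume x: "x \<in> polydisc a (e / CARD('n))"
    have "norm (x - a) \<le> (\<Sum>k\<in>UNIV. norm ((x - a) $ k))"
      unfolding norm_vec_def by (rule L2_set_le_sum) auto
    also have "\<dots> < (\<Sum>k\<in>(UNIV :: 'n set). e / CARD('n))"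
      using x by (intro sum_strict_mono) (auto simp: polydisc_def dist_norm)
    finally show "x \<in> ball a e" by (simp add: dist_norm norm_minus_commute)
  qed
  then show thesis using that[of "e / CARD('n)"] e by auto
qed

lemma slice_in_polydisc_iff:
  assumes "x \<in> polydisc a \<rho>"
  shows "x + axis k t \<in> polydisc a \<rho> \<longleftrightarrow> t \<in> ball (a $ k - x $ k) \<rho>"
proof -
  have "dist ((x + axis k t) $ j) (a $ j) = (if j = k then dist (a $ k - x $ k) t else dist (x $ j) (a $ j))"
    for j
    by (simp add: axis_def dist_norm norm_minus_commute algebra_simps)
  then show ?thesis
    using assms unfolding polydisc_def by auto
qed

lemma polydisc_induct [consumes 2, case_names centre slice]:
  fixes x z :: "complex^'n::finite"
  assumes x: "x \<in> polydisc a \<rho>" and z: "z \<in> polydisc a \<rho>" and "R x"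
    and step: "\<And>y k t. y \<in> polydisc a \<rho> \<Longrightarrow> R y \<Longrightarrow> y + axis k t \<in> polydisc a \<rho> \<Longrightarrow> R (y + axis k t)"
  shows "R z"
proof -
  define mixed where "mixed S = (\<chi> k. if k \<in> S then z $ k else x $ k)" for S
  have mixed: "mixed S \<in> polydisc a \<rho>" for S
    using x z by (auto simp: polydisc_def mixed_def)
  have "R (mixed S)" if "finite S" for S
    using that
  proof induction
    case empty
    then show ?case using \<open>R x\<close> by (simp add: mixed_def)
  next
    case (insert k S)
    have "mixed (insert k S) = mixed S + axis k (z $ k - x $ k)"
      using insert.hyps by (auto simp: mixed_def vec_eq_iff axis_def)
    then show ?case
      using step[OF mixed insert.IH, of k "z $ k - x $ k"] mixed[of "insert k S"] by simp
  qed
  from this[of UNIV] show ?thesis by (simp add: mixed_def)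
qed

lemma polydisc_constant:
  assumes f: "f sep_holomorphic_on polydisc a \<rho>" and x: "x \<in> polydisc a \<rho>" and z: "z \<in> polydisc a \<rho>"
    and pd0: "\<And>y k. y \<in> polydisc a \<rho> \<Longrightarrow> pd k f y = 0"
  shows "f z = f x"
  using x z
proof (induction rule: polydisc_induct)
  case (slice y k t)
  define S where "S = ball (a $ k - y $ k) \<rho>"
  have S: "s \<in> S \<longleftrightarrow> y + axis k s \<in> polydisc a \<rho>" for s
    using slice_in_polydisc_iff[OF slice.hyps(1)] by (simp add: S_def)
  have "\<exists>c. \<forall>s\<in>S. f (y + axis k s) = c"
  proof (rule has_field_derivative_zero_constant)
    show "((\<lambda>s. f (y + axis k s)) has_field_derivative 0) (at s within S)" if "s \<in> S" for s
      using has_field_derivative_slice[OF f] pd0 that S by (metis has_field_derivative_at_within)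
  qed (simp add: S_def)
  moreover have "0 \<in> S" "t \<in> S"
    using slice.hyps by (auto simp: S)
  ultimately have "f (y + axis k t) = f (y + axis k 0)" by metis
  with slice.IH show ?case by simp
qed simp

lemma pd_zero_imp_locally_constant:
  assumes f: "f sep_holomorphic_on U" and U: "open U" and a: "a \<in> U"
    and pd0: "\<And>x k. x \<in> U \<Longrightarrow> pd k f x = 0"
  shows "\<forall>\<^sub>F x in nhds a. f x = f a"
proof -
  obtain \<rho> where \<rho>: "\<rho> > 0" "polydisc a \<rho> \<subseteq> U" using open_contains_polydisc[OF U a] .
  from eventually_nhds_in_open[OF open_polydisc centre_in_polydisc[OF \<rho>(1)]] show ?thesis
  proof (rule eventually_mono)
    show "f x = f a" if "x \<in> polydisc a \<rho>" for x
      using \<rho>(2) pd0 that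
      by (intro polydisc_constant[OF sep_holomorphic_on_subset[OF f \<rho>(2)] centre_in_polydisc[OF \<rho>(1)]]) auto
  qed
qed

lemma polydisc_slice_vanishes:
  assumes f: "f sep_holomorphic_on polydisc a \<rho>"
    and b: "b \<in> polydisc a \<rho>" "\<forall>\<^sub>F x in nhds b. f x = 0" and t: "b + axis k t \<in> polydisc a \<rho>"
  shows "f (b + axis k t) = 0"
proof -
  define S where "S = ball (a $ k - b $ k) \<rho>"
  have S: "s \<in> S \<longleftrightarrow> b + axis k s \<in> polydisc a \<rho>" for s
    using slice_in_polydisc_iff[OF b(1)] by (simp add: S_def)
  have "\<forall>\<^sub>F s in nhds 0. f (b + axis k s) = 0"
    using b(2) by (rule eventually_slice)
  moreover have "\<forall>\<^sub>F s in nhds 0. s \<in> S"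
    using b(1) S[of 0] by (intro eventually_nhds_in_open) (auto simp: S_def)
  ultimately have "\<forall>\<^sub>F s in nhds 0. f (b + axis k s) = 0 \<and> s \<in> S"
    by (rule eventually_conj)
  then obtain T where T: "open T" "0 \<in> T" "\<And>s. s \<in> T \<Longrightarrow> f (b + axis k s) = 0 \<and> s \<in> S"
    unfolding eventually_nhds by blast
  have hol: "(\<lambda>s. f (b + axis k s)) holomorphic_on S"
    using S by (intro slice_holomorphic_on[OF f]) simp
  show ?thesis
  proof (rule analytic_continuation_open[where f = "\<lambda>s. f (b + axis k s)" and g = "\<lambda>_. 0"
        and s = T and s' = S])
    show "t \<in> S" using t by (simp add: S)
  qed (use T hol in \<open>auto simp: S_def\<close>)
qed

lemma polydisc_identity:
  assumes f: "f sep_holomorphic_on polydisc a \<rho>" and x: "x \<in> polydisc a \<rho>" and z: "z \<in> polydisc a \<rho>"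
    and "\<forall>\<^sub>F y in nhds x. f y = 0"
  shows "\<forall>\<^sub>F y in nhds z. f y = 0"
  using x z
proof (induction rule: polydisc_induct)
  case (slice y k t)
  have "\<forall>\<^sub>F b in nhds y. b \<in> polydisc a \<rho> \<and> (\<forall>\<^sub>F w in nhds b. f w = 0)"
    using slice.hyps(1) slice.IH
    by (intro eventually_conj) (simp_all add: eventually_nhds_in_open open_polydisc eventually_eventually)
  moreover have "filterlim (\<lambda>w. w - axis k t) (nhds y) (nhds (y + axis k t))"
    by (rule filterlim_compose[OF _ tendsto_diff[OF filterlim_ident tendsto_const]]) (simp add: filterlim_ident)
  ultimately have "\<forall>\<^sub>F w in nhds (y + axis k t).
      w - axis k t \<in> polydisc a \<rho> \<and> (\<forall>\<^sub>F v in nhds (w - axis k t). f v = 0)"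
    unfolding filterlim_iff by blast
  moreover have "\<forall>\<^sub>F w in nhds (y + axis k t). w \<in> polydisc a \<rho>"
    using open_polydisc slice.hyps(2) by (rule eventually_nhds_in_open)
  ultimately show ?case
  proof eventually_elim
    case (elim w)
    then show ?case
      using polydisc_slice_vanishes[OF f, of "w - axis k t" k t] by simp
  qed
qed fact

lemma vanishing_germ_locally_constant:
  assumes f: "f sep_holomorphic_on U" and U: "open U" and a: "a \<in> U"
  shows "\<forall>\<^sub>F s in nhds a. (\<forall>\<^sub>F x in nhds s. f x = 0) \<longleftrightarrow> (\<forall>\<^sub>F x in nhds a. f x = 0)"
proof -
  obtain \<rho> where \<rho>: "\<rho> > 0" "polydisc a \<rho> \<subseteq> U" using open_contains_polydisc[OF U a] .
  note identity = polydisc_identity[OF sep_holomorphic_on_subset[OF f \<rho>(2)]]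
  from eventually_nhds_in_open[OF open_polydisc centre_in_polydisc[OF \<rho>(1)]] show ?thesis
    by (rule eventually_mono) (use identity centre_in_polydisc[OF \<rho>(1)] in blast)
qed

lemma eventually_eq_zero_cong:
  assumes "\<forall>\<^sub>F x in F. f x = g x"
  shows "(\<forall>\<^sub>F x in F. f x = 0) \<longleftrightarrow> (\<forall>\<^sub>F x in F. g x = 0)"
  by (rule eventually_subst) (use assms in \<open>auto elim: eventually_mono\<close>)

lemma eventually_weyl_vanishing_germ_iff:
  assumes P: "P \<in> weyl" and f: "f sep_holomorphic_on U" and U: "open U" "a \<in> U"
    and lim: "(\<gamma> \<longlongrightarrow> a) G" and eq: "\<forall>\<^sub>F s in G. \<forall>\<^sub>F x in nhds (\<gamma> s). F s x = f x"
  shows "\<forall>\<^sub>F s in G. (\<forall>\<^sub>F x in nhds (\<gamma> s). P (F s) x = 0) \<longleftrightarrow> (\<forall>\<^sub>F x in nhds a. P f x = 0)"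
proof -
  have "\<forall>\<^sub>F y in nhds a. (\<forall>\<^sub>F x in nhds y. P f x = 0) \<longleftrightarrow> (\<forall>\<^sub>F x in nhds a. P f x = 0)"
    by (rule vanishing_germ_locally_constant[OF sep_holomorphic_on_weyl[OF P f U(1)] U])
  then have "\<forall>\<^sub>F s in G. (\<forall>\<^sub>F x in nhds (\<gamma> s). P f x = 0) \<longleftrightarrow> (\<forall>\<^sub>F x in nhds a. P f x = 0)"
    using lim unfolding filterlim_iff by blast
  with eq show ?thesis
  proof eventually_elim
    case (elim s)
    then show ?case
      using eventually_eq_zero_cong[OF weyl_cong_ev[OF P elim(1)]] by simp
  qed
qed

lemma continues_toE:
  assumes "continues_to g q f p"
  obtains \<gamma> F where "continuous_on {0..1} \<gamma>" "\<gamma> 0 = q" "\<gamma> 1 = p"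
    "\<And>t. t \<in> {0..1} \<Longrightarrow> \<exists>U. open U \<and> \<gamma> t \<in> U \<and> F t sep_holomorphic_on U"
    "\<And>t. t \<in> {0..1} \<Longrightarrow> \<forall>\<^sub>F s in at t within {0..1}. \<forall>\<^sub>F x in nhds (\<gamma> s). F s x = F t x"
    "\<forall>\<^sub>F x in nhds q. F (0::real) x = g x" "\<forall>\<^sub>F x in nhds p. F 1 x = f x"
proof -
  obtain \<gamma> F \<rho> where \<gamma>: "path \<gamma>" "pathstart \<gamma> = q" "pathfinish \<gamma> = p"
    and F: "\<And>t. t \<in> {0..1} \<Longrightarrow> \<rho> t > 0 \<and> F t mholomorphic_on ball (\<gamma> t) (\<rho> t)"
    and coherent: "\<And>t. t \<in> {0..1} \<Longrightarrow> \<exists>\<delta>>0. \<forall>s\<in>{0..1}. \<bar>s - t\<bar> < \<delta> \<longrightarrow>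
           (\<forall>\<^sub>F x in nhds (\<gamma> s). F s x = F t x)"
    and ends: "\<forall>\<^sub>F x in nhds q. F (0::real) x = g x" "\<forall>\<^sub>F x in nhds p. F 1 x = f x"
    using assms unfolding continues_to_def by (elim exE conjE) blast
  have "\<exists>U. open U \<and> \<gamma> t \<in> U \<and> F t sep_holomorphic_on U" if "t \<in> {0..1}" for t
    using F[OF that] mholomorphic_on_imp_sep_holomorphic_on by (intro exI[of _ "ball (\<gamma> t) (\<rho> t)"]) auto
  moreover have "\<forall>\<^sub>F s in at t within {0..1}. \<forall>\<^sub>F x in nhds (\<gamma> s). F s x = F t x" if "t \<in> {0..1}" for t
    using coherent[OF that] unfolding eventually_at dist_real_def by blast
  ultimately show thesis
    using \<gamma> ends by (intro that[of \<gamma> F]) (simp_all add: path_def pathstart_def pathfinish_def)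
qed

lemma weyl_vanishing_continues_to_iff:
  assumes P: "P \<in> weyl" and cont: "continues_to g q f p"
  shows "(\<forall>\<^sub>F x in nhds q. P g x = 0) \<longleftrightarrow> (\<forall>\<^sub>F x in nhds p. P f x = 0)"
  using cont
proof (rule continues_toE)
  fix \<gamma> F
  assume \<gamma>: "continuous_on {0..1} \<gamma>" "\<gamma> 0 = q" "\<gamma> 1 = p"
    and hol: "\<And>t. t \<in> {0..1} \<Longrightarrow> \<exists>U. open U \<and> \<gamma> t \<in> U \<and> F t sep_holomorphic_on U"
    and coherent: "\<And>t. t \<in> {0..1} \<Longrightarrow> \<forall>\<^sub>F s in at t within {0..1}. \<forall>\<^sub>F x in nhds (\<gamma> s). F s x = F t x"
    and start: "\<forall>\<^sub>F x in nhds q. F (0::real) x = g x" and finish: "\<forall>\<^sub>F x in nhds p. F 1 x = f x"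
  define vanishing where "vanishing t \<longleftrightarrow> (\<forall>\<^sub>F x in nhds (\<gamma> t). P (F t) x = 0)" for t
  have "vanishing 0 = vanishing 1"
  proof (rule connected_local_const[of "{0..1::real}"])
    show "\<forall>t\<in>{0..1}. \<forall>\<^sub>F s in at t within {0..1}. vanishing t = vanishing s"
    proof
      fix t :: real assume t: "t \<in> {0..1}"
      obtain U where U: "open U" "\<gamma> t \<in> U" "F t sep_holomorphic_on U"
        using hol[OF t] by blast
      have "(\<gamma> \<longlongrightarrow> \<gamma> t) (at t within {0..1})"
        using \<gamma>(1) t unfolding continuous_on_def by blast
      from eventually_weyl_vanishing_germ_iff[OF P U(3,1,2) this coherent[OF t]]
      show "\<forall>\<^sub>F s in at t within {0..1}. vanishing t = vanishing s"
        by eventually_elim (simp add: vanishing_def)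
    qed
  qed auto
  moreover have "vanishing 0 \<longleftrightarrow> (\<forall>\<^sub>F x in nhds q. P g x = 0)"
    using eventually_eq_zero_cong[OF weyl_cong_ev[OF P start]] \<gamma>(2) by (simp add: vanishing_def)
  moreover have "vanishing 1 \<longleftrightarrow> (\<forall>\<^sub>F x in nhds p. P f x = 0)"
    using eventually_eq_zero_cong[OF weyl_cong_ev[OF P finish]] \<gamma>(3) by (simp add: vanishing_def)
  ultimately show ?thesis by simp
qed


section \<open>Branches of monomials\<close>

definition log_branch :: "(complex^'n::finite \<Rightarrow> complex^'n) \<Rightarrow> (complex^'n) set \<Rightarrow> bool" where
  "log_branch L U \<longleftrightarrow>
     (\<forall>j. (\<lambda>x. L x $ j) sep_holomorphic_on U) \<and> (\<forall>x\<in>U. \<forall>j. exp (L x $ j) = x $ j)"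

definition monomial :: "(complex^'n::finite \<Rightarrow> complex^'n) \<Rightarrow> complex^'n \<Rightarrow> complex^'n \<Rightarrow> complex" where
  "monomial L y x = exp (\<Sum>j\<in>UNIV. y $ j * L x $ j)"

lemma log_branch_subset: "log_branch L U \<Longrightarrow> V \<subseteq> U \<Longrightarrow> log_branch L V"
  unfolding log_branch_def using sep_holomorphic_on_subset by blast

lemma log_branch_nonzero: "log_branch L U \<Longrightarrow> x \<in> U \<Longrightarrow> x $ j \<noteq> 0"
  unfolding log_branch_def by (metis exp_not_eq_zero)

lemma monomial_nonzero: "monomial L y x \<noteq> 0"
  by (simp add: monomial_def)

lemma monomial_uminus: "monomial L (- y) x = inverse (monomial L y x)"
  by (simp add: monomial_def sum_negf exp_minus)

lemma monomial_add_cvec: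
  assumes L: "log_branch L U" and x: "x \<in> U"
  shows "monomial L (y + cvec l) x = monomial L y x * (\<Prod>k\<in>UNIV. (x $ k) powi (l $ k))"
proof -
  have "exp (of_int (l $ k) * L x $ k) = (x $ k) powi (l $ k)" for k
    using L x unfolding log_branch_def by (metis exp_power_int mult.commute)
  then show ?thesis
    by (simp add: monomial_def cvec_def distrib_right sum.distrib exp_add exp_sum)
qed

lemma monomial_add_axis:
  assumes L: "log_branch L U" and x: "x \<in> U"
  shows "monomial L (y + axis k 1) x = x $ k * monomial L y x"
proof -
  have "(\<Sum>j\<in>UNIV. (y + axis k 1) $ j * L x $ j) = (\<Sum>j\<in>UNIV. y $ j * L x $ j) + L x $ k"
    by (simp add: distrib_right sum.distrib axis_def if_distrib[of "\<lambda>c. c * _"] cong: if_cong)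
  moreover have "exp (L x $ k) = x $ k"
    using assms unfolding log_branch_def by blast
  ultimately show ?thesis
    by (simp add: monomial_def exp_add)
qed

lemma sep_holomorphic_on_monomial [sep_holomorphic_intros]:
  "log_branch L U \<Longrightarrow> monomial L y sep_holomorphic_on U"
  unfolding log_branch_def monomial_def[abs_def] by (intro sep_holomorphic_intros) auto

lemma pd_log_branch:
  assumes L: "log_branch L U" and U: "open U" and x: "x \<in> U"
  shows "x $ j * pd k (\<lambda>x. L x $ j) x = (if j = k then 1 else 0)"
proof -
  have Lj: "(\<lambda>x. L x $ j) sep_holomorphic_on U" and eL: "\<And>x. x \<in> U \<Longrightarrow> exp (L x $ j) = x $ j"
    using L unfolding log_branch_def by auto
  have "pd k (\<lambda>x. exp (L x $ j)) x = pd k (\<lambda>x. x $ j) x"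
    by (rule weyl_cong[OF weyl.pd U eL x])
  then show ?thesis
    using pd_exp[OF Lj x] eL[OF x] by (simp add: pd_coordinate)
qed

lemma coordinate_pd_monomial:
  assumes L: "log_branch L U" and U: "open U" and x: "x \<in> U"
  shows "x $ k * pd k (monomial L y) x = y $ k * monomial L y x"
proof -
  have Lj: "(\<lambda>x. L x $ j) sep_holomorphic_on U" for j
    using L unfolding log_branch_def by blast
  have "pd k (monomial L y) x = monomial L y x * pd k (\<lambda>x. \<Sum>j\<in>UNIV. y $ j * L x $ j) x"
    unfolding monomial_def[abs_def] using Lj by (intro pd_exp[OF _ x] sep_holomorphic_intros)
  also have "pd k (\<lambda>x. \<Sum>j\<in>UNIV. y $ j * L x $ j) x = (\<Sum>j\<in>UNIV. y $ j * pd k (\<lambda>x. L x $ j) x)"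
    using Lj x by (simp add: pd_sum[of _ _ U] pd_cmult[OF Lj x] sep_holomorphic_intros)
  finally have "pd k (monomial L y) x = monomial L y x * (\<Sum>j\<in>UNIV. y $ j * pd k (\<lambda>x. L x $ j) x)" .
  moreover have "pd k (\<lambda>x. L x $ j) x = (if j = k then 1 / x $ k else 0)" for j
    using pd_log_branch[OF L U x, of j k] log_branch_nonzero[OF L x, of j]
    by (auto simp: field_simps split: if_splits)
  ultimately show ?thesis
    using log_branch_nonzero[OF L x, of k] by (simp add: if_distrib cong: if_cong)
qed

lemma pd_monomial:
  assumes L: "log_branch L U" and U: "open U" and x: "x \<in> U"
  shows "pd k (monomial L y) x = y $ k * monomial L (y - axis k 1) x"
proof -
  have "x $ k * pd k (monomial L y) x = x $ k * (y $ k * monomial L (y - axis k 1) x)"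
    using coordinate_pd_monomial[OF assms, of k y] monomial_add_axis[OF L x, of "y - axis k 1" k] by simp
  then show ?thesis using log_branch_nonzero[OF L x, of k] by simp
qed

text \<open>The operators \<open>x\<^sub>k \<partial>\<^sub>k - y\<^sub>k\<close> annihilate \<open>x\<^sup>y\<close>, hence also its continuation, and up to a factor they
  characterize \<open>x\<^sup>y\<close>.\<close>

definition eigen_op :: "complex^'n \<Rightarrow> 'n::finite \<Rightarrow> (complex^'n \<Rightarrow> complex) \<Rightarrow> complex^'n \<Rightarrow> complex" where
  "eigen_op y k f x = x $ k * pd k f x + (- y $ k) * f x"

lemma weyl_eigen_op: "eigen_op y k \<in> weyl"
proof -
  have "(\<lambda>f x. x $ k * pd k f x + (- y $ k) * id f x) \<in> weyl"
    by (intro weyl.add weyl_coordinate_mult weyl_cmult weyl.pd weyl_id)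
  then show ?thesis by (simp add: eigen_op_def[abs_def])
qed

lemma eigen_op_monomial:
  assumes L: "log_branch L V" "open V" "q \<in> V" and h: "\<forall>\<^sub>F x in nhds q. h x = c * monomial L y x"
  shows "\<forall>\<^sub>F x in nhds q. eigen_op y k h x = 0"
  using h weyl_cong_ev[OF weyl.pd[of k] h] eventually_nhds_in_open[OF L(2,3)]
proof eventually_elim
  case (elim x)
  then show ?case
    using coordinate_pd_monomial[OF L(1,2), of x k y]
    by (simp add: eigen_op_def pd_cmult[OF sep_holomorphic_on_monomial[OF L(1)]] algebra_simps)
qed

lemma eigen_op_zero_imp_monomial:
  assumes L: "log_branch L U" and U: "open U" and p: "p \<in> U" and h: "h sep_holomorphic_on U"
    and eigen: "\<And>x k. x \<in> U \<Longrightarrow> eigen_op y k h x = 0"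
  obtains c where "\<forall>\<^sub>F x in nhds p. h x = c * monomial L y x"
proof -
  define G where "G x = h x * monomial L (- y) x" for x
  note mono = sep_holomorphic_on_monomial[OF L, of "- y"]
  have "pd k G x = 0" if x: "x \<in> U" for x k
  proof -
    have "x $ k * pd k G x = x $ k * pd k h x * monomial L (- y) x + h x * (x $ k * pd k (monomial L (- y)) x)"
      unfolding G_def[abs_def] using pd_mult[OF h mono x] by (simp add: algebra_simps)
    also have "\<dots> = 0"
      using eigen[OF x, of k] coordinate_pd_monomial[OF L U x, of k "- y"]
      by (simp add: eigen_op_def algebra_simps)
    finally show ?thesis using log_branch_nonzero[OF L x] by simp
  qed
  then have "\<forall>\<^sub>F x in nhds p. G x = G p"
    by (intro pd_zero_imp_locally_constant[OF _ U p])
      (auto simp: G_def[abs_def] intro: sep_holomorphic_intros h mono)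
  then have "\<forall>\<^sub>F x in nhds p. h x = G p * monomial L y x"
    by eventually_elim (simp add: G_def monomial_uminus field_simps monomial_nonzero)
  then show thesis by (rule that)
qed

lemma eventually_monomial_multiple_eq_zero_iff:
  assumes "\<forall>\<^sub>F x in nhds q. h x = c * monomial L y x"
  shows "(\<forall>\<^sub>F x in nhds q. h x = 0) \<longleftrightarrow> c = 0"
  unfolding eventually_eq_zero_cong[OF assms]
  by (simp add: monomial_nonzero)

lemma weyl_monomial_continues_to:
  assumes P: "P \<in> weyl" and cont: "continues_to g q f p"
    and L': "log_branch L' V" "open V" "q \<in> V" and L: "log_branch L U" "open U" "p \<in> U"
    and f: "f sep_holomorphic_on U" and Pg: "\<forall>\<^sub>F x in nhds q. P g x = c * monomial L' y x"
  obtains c' where "\<forall>\<^sub>F x in nhds p. P f x = c' * monomial L y x" "c' = 0 \<longleftrightarrow> c = 0"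
proof -
  have "\<forall>\<^sub>F x in nhds p. eigen_op y k (P f) x = 0" for k
    using weyl_vanishing_continues_to_iff[OF weyl.mult[OF weyl_eigen_op P] cont, of y k]
      eigen_op_monomial[OF L' Pg] by simp
  then have "\<forall>\<^sub>F x in nhds p. (\<forall>k. eigen_op y k (P f) x = 0) \<and> x \<in> U"
    using eventually_nhds_in_open[OF L(2,3)] by (intro eventually_conj eventually_all_finite)
  then obtain W where W: "open W" "p \<in> W" "\<And>x. x \<in> W \<Longrightarrow> (\<forall>k. eigen_op y k (P f) x = 0) \<and> x \<in> U"
    unfolding eventually_nhds by blast
  have hol: "P f sep_holomorphic_on W"
    using W(3) sep_holomorphic_on_subset[OF f] by (intro sep_holomorphic_on_weyl[OF P _ W(1)]) blast
  have L_W: "log_branch L W"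
    using W(3) by (intro log_branch_subset[OF L(1)]) blast
  obtain c' where c': "\<forall>\<^sub>F x in nhds p. P f x = c' * monomial L y x"
    by (rule eigen_op_zero_imp_monomial[OF L_W W(1,2) hol]) (use W(3) in blast)
  moreover have "c' = 0 \<longleftrightarrow> c = 0"
    using weyl_vanishing_continues_to_iff[OF P cont] eventually_monomial_multiple_eq_zero_iff[OF c']
      eventually_monomial_multiple_eq_zero_iff[OF Pg] by simp
  ultimately show thesis by (rule that)
qed


section \<open>Normally convergent series\<close>

definition normal_series ::
  "'i set \<Rightarrow> ('i \<Rightarrow> complex^'n::finite \<Rightarrow> complex) \<Rightarrow> (complex^'n \<Rightarrow> complex) \<Rightarrow> complex^'n \<Rightarrow> real \<Rightarrow> bool" where
  "normal_series I T f q \<epsilon> \<longleftrightarrow> \<epsilon> > 0 \<and>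
     (\<exists>M. M summable_on I \<and>
        (\<forall>i\<in>I. T i sep_holomorphic_on ball q \<epsilon> \<and> (\<forall>x\<in>ball q \<epsilon>. norm (T i x) \<le> M i))) \<and>
     (\<forall>x\<in>ball q \<epsilon>. ((\<lambda>i. T i x) has_sum f x) I)"

lemma normal_seriesE:
  assumes "normal_series I T f q \<epsilon>"
  obtains M where "\<epsilon> > 0" "M summable_on I" "\<And>i. i \<in> I \<Longrightarrow> T i sep_holomorphic_on ball q \<epsilon>"
    "\<And>i x. i \<in> I \<Longrightarrow> x \<in> ball q \<epsilon> \<Longrightarrow> norm (T i x) \<le> M i"
    "\<And>x. x \<in> ball q \<epsilon> \<Longrightarrow> ((\<lambda>i. T i x) has_sum f x) I"
  using assms unfolding normal_series_def by blast

lemma normal_series_uniform_limit: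
  assumes "normal_series I T f q \<epsilon>"
  shows "uniform_limit (ball q \<epsilon>) (\<lambda>F x. \<Sum>i\<in>F. T i x) f (finite_subsets_at_top I)"
    and "\<forall>\<^sub>F F in finite_subsets_at_top I. (\<lambda>x. \<Sum>i\<in>F. T i x) sep_holomorphic_on ball q \<epsilon>"
proof -
  obtain M where M: "M summable_on I" "\<And>i. i \<in> I \<Longrightarrow> T i sep_holomorphic_on ball q \<epsilon>"
    "\<And>i x. i \<in> I \<Longrightarrow> x \<in> ball q \<epsilon> \<Longrightarrow> norm (T i x) \<le> M i"
    and sum: "\<And>x. x \<in> ball q \<epsilon> \<Longrightarrow> ((\<lambda>i. T i x) has_sum f x) I"
    by (rule normal_seriesE[OF assms]) (rule that)
  show "uniform_limit (ball q \<epsilon>) (\<lambda>F x. \<Sum>i\<in>F. T i x) f (finite_subsets_at_top I)"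
    by (rule Weierstrass_m_test_general'[OF M(3) sum M(1)])
  show "\<forall>\<^sub>F F in finite_subsets_at_top I. (\<lambda>x. \<Sum>i\<in>F. T i x) sep_holomorphic_on ball q \<epsilon>"
    by (intro eventually_finite_subsets_at_top_weakI sep_holomorphic_on_sum M(2)) auto
qed

lemma normal_series_sep_holomorphic_on:
  assumes "normal_series I T f q \<epsilon>"
  shows "f sep_holomorphic_on ball q \<epsilon>"
  using normal_series_uniform_limit[OF assms]
  by (intro sep_holomorphic_on_uniform_limit[where F = "finite_subsets_at_top I"]) auto

lemma normal_series_cong:
  assumes series: "normal_series I T f q \<epsilon>"
    and T: "\<And>i x. i \<in> I \<Longrightarrow> x \<in> ball q \<epsilon> \<Longrightarrow> T i x = T' i x"
    and f: "\<And>x. x \<in> ball q \<epsilon> \<Longrightarrow> f x = f' x"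
  shows "normal_series I T' f' q \<epsilon>"
proof -
  obtain M where M: "\<epsilon> > 0" "M summable_on I" "\<And>i. i \<in> I \<Longrightarrow> T i sep_holomorphic_on ball q \<epsilon>"
    "\<And>i x. i \<in> I \<Longrightarrow> x \<in> ball q \<epsilon> \<Longrightarrow> norm (T i x) \<le> M i"
    and sum: "\<And>x. x \<in> ball q \<epsilon> \<Longrightarrow> ((\<lambda>i. T i x) has_sum f x) I"
    by (rule normal_seriesE[OF series]) (rule that)
  have "T' i sep_holomorphic_on ball q \<epsilon>" if "i \<in> I" for i
    using sep_holomorphic_on_cong[OF M(3)[OF that] open_ball T[OF that]] .
  moreover have "norm (T' i x) \<le> M i" if "i \<in> I" "x \<in> ball q \<epsilon>" for i x
    using M(4)[OF that] T[OF that] by simp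
  moreover have "((\<lambda>i. T' i x) has_sum f' x) I" if "x \<in> ball q \<epsilon>" for x
    using sum[OF that] f[OF that] has_sum_cong[of I "\<lambda>i. T i x" "\<lambda>i. T' i x"] T that by simp
  ultimately show ?thesis
    unfolding normal_series_def using M(1,2) by blast
qed

lemma normal_series_has_sum_pd:
  assumes series: "normal_series I T f q \<epsilon>" and x: "x \<in> ball q \<epsilon>"
  shows "((\<lambda>i. pd k (T i) x) has_sum pd k f x) I"
proof -
  have hol: "T i sep_holomorphic_on ball q \<epsilon>" if "i \<in> I" for i
    using series that unfolding normal_series_def by blast
  have "((\<lambda>F. pd k (\<lambda>x. \<Sum>i\<in>F. T i x) x) \<longlongrightarrow> pd k f x) (finite_subsets_at_top I)"
    using normal_series_uniform_limit[OF series] x by (intro slice_uniform_limit(2)[where V = "ball q \<epsilon>"]) auto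
  moreover have "\<forall>\<^sub>F F in finite_subsets_at_top I. pd k (\<lambda>x. \<Sum>i\<in>F. T i x) x = (\<Sum>i\<in>F. pd k (T i) x)"
    by (intro eventually_finite_subsets_at_top_weakI pd_sum[OF hol x]) auto
  ultimately show ?thesis
    unfolding has_sum_def by (rule Lim_transform_eventually)
qed

lemma normal_series_pd:
  assumes series: "normal_series I T f q \<epsilon>"
  shows "normal_series I (\<lambda>i. pd k (T i)) (pd k f) q (\<epsilon> / 2)"
proof -
  obtain M where \<epsilon>: "\<epsilon> > 0" and M: "M summable_on I" "\<And>i. i \<in> I \<Longrightarrow> T i sep_holomorphic_on ball q \<epsilon>"
    "\<And>i x. i \<in> I \<Longrightarrow> x \<in> ball q \<epsilon> \<Longrightarrow> norm (T i x) \<le> M i"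
    by (rule normal_seriesE[OF series]) (rule that)
  have sub: "ball q (\<epsilon> / 2) \<subseteq> ball q \<epsilon>" using \<epsilon> by (intro subset_ball) simp
  have "pd k (T i) sep_holomorphic_on ball q (\<epsilon> / 2)" if "i \<in> I" for i
    using sep_holomorphic_on_subset[OF sep_holomorphic_on_pd[OF M(2)[OF that] open_ball] sub] .
  moreover have "norm (pd k (T i) x) \<le> M i / (\<epsilon> / 4)" if i: "i \<in> I" and x: "x \<in> ball q (\<epsilon> / 2)" for i x
  proof -
    have "cball x (\<epsilon> / 4) \<subseteq> ball q \<epsilon>"
    proof
      fix z assume "z \<in> cball x (\<epsilon> / 4)"
      then show "z \<in> ball q \<epsilon>" using x \<epsilon> dist_triangle[of q z x] by simp
    qed
    then show ?thesis
      using \<epsilon> by (intro norm_pd_le[OF M(2)[OF i] _ _ M(3)[OF i]]) auto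
  qed
  moreover have "(\<lambda>i. M i / (\<epsilon> / 4)) summable_on I"
    using summable_on_cmult_left[OF M(1), of "inverse (\<epsilon> / 4)"] by (simp only: divide_inverse)
  ultimately show ?thesis
    unfolding normal_series_def using \<epsilon> normal_series_has_sum_pd[OF series] sub
    by (intro conjI exI[of _ "\<lambda>i. M i / (\<epsilon> / 4)"]) auto
qed

lemma normal_series_pd_monomial:
  assumes L: "log_branch L (ball q \<epsilon>)"
    and series: "normal_series I (\<lambda>i x. c i * monomial L (y i) x) f q \<epsilon>"
  shows "normal_series I (\<lambda>i x. y i $ k * c i * monomial L (y i - axis k 1) x) (pd k f) q (\<epsilon> / 2)"
proof (rule normal_series_cong[OF normal_series_pd[OF series, of k]])
  fix i x assume "x \<in> ball q (\<epsilon> / 2)"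
  moreover have "ball q (\<epsilon> / 2) \<subseteq> ball q \<epsilon>"
    using series unfolding normal_series_def by (intro subset_ball) simp
  ultimately have x: "x \<in> ball q \<epsilon>" by blast
  show "pd k (\<lambda>x. c i * monomial L (y i) x) x = y i $ k * c i * monomial L (y i - axis k 1) x"
    using pd_cmult[OF sep_holomorphic_on_monomial[OF L] x] pd_monomial[OF L open_ball x] by simp
qed simp


section \<open>Coefficients of the logarithm-free series\<close>

lemma cvec_add [simp]: "cvec (a + b) = cvec a + cvec b"
  and cvec_diff [simp]: "cvec (a - b) = cvec a - cvec b"
  and cvec_axis [simp]: "cvec (axis k 1) = axis k 1"
  and cvec_zero [simp]: "cvec 0 = 0"
  by (auto simp: cvec_def vec_eq_iff axis_def)

definition int_vec :: "nat^'n \<Rightarrow> int^'n" where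
  "int_vec u = (\<chi> j. int (u $ j))"

lemma int_vec_nth [simp]: "int_vec u $ j = int (u $ j)"
  by (simp add: int_vec_def)

lemma int_vec_zero: "int_vec 0 = 0"
  and int_vec_add_axis: "int_vec (u + axis k 1) = int_vec u + axis k 1"
  by (auto simp: vec_eq_iff axis_def)

definition int_kernel :: "int^'n^'d \<Rightarrow> (int^'n::finite) set" where
  "int_kernel A = {l. A *v l = 0}"

lemma int_kernel_zero: "0 \<in> int_kernel A"
  and int_kernel_add: "a \<in> int_kernel A \<Longrightarrow> b \<in> int_kernel A \<Longrightarrow> a + b \<in> int_kernel A"
  and int_kernel_diff: "a \<in> int_kernel A \<Longrightarrow> b \<in> int_kernel A \<Longrightarrow> a - b \<in> int_kernel A"
  by (auto simp: int_kernel_def matrix_vector_right_distrib matrix_vector_mult_diff_distrib)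

definition min_nsupp :: "int^'n::finite^'d \<Rightarrow> complex^'n \<Rightarrow> bool" where
  "min_nsupp A u \<longleftrightarrow> (\<forall>l\<in>int_kernel A. nsupp (u + cvec l) \<subseteq> nsupp u \<longrightarrow> nsupp (u + cvec l) = nsupp u)"

lemma in_nsupp_add_cvec_iff:
  "i \<in> nsupp (u + cvec l) \<longleftrightarrow> (\<exists>m::int. m < 0 \<and> u $ i + of_int (l $ i) = of_int m)"
  by (simp add: nsupp_def cvec_def)

lemma nsupp_add_cvec_antimono: "l $ i \<ge> l' $ i \<Longrightarrow> i \<in> nsupp (u + cvec l) \<Longrightarrow> i \<in> nsupp (u + cvec l')"
proof -
  assume le: "l $ i \<ge> l' $ i" and "i \<in> nsupp (u + cvec l)"
  then obtain m :: int where m: "m < 0" "u $ i + of_int (l $ i) = of_int m"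
    unfolding in_nsupp_add_cvec_iff by blast
  then have "u $ i + of_int (l' $ i) = of_int (m - (l $ i - l' $ i))"
    by (simp add: algebra_simps)
  with m(1) le show ?thesis
    unfolding in_nsupp_add_cvec_iff by (intro exI[of _ "m - (l $ i - l' $ i)"]) simp
qed

lemma nsupp_minus_axis:
  assumes "u $ k + of_int (l $ k) \<noteq> 0"
  shows "nsupp (u + cvec (l - axis k 1)) = nsupp (u + cvec l)"
proof
  show "nsupp (u + cvec (l - axis k 1)) \<subseteq> nsupp (u + cvec l)"
  proof
    fix i assume i: "i \<in> nsupp (u + cvec (l - axis k 1))"
    then obtain m :: int where m: "m < 0" "u $ i + of_int ((l - axis k 1) $ i) = of_int m"
      unfolding in_nsupp_add_cvec_iff by blast
    show "i \<in> nsupp (u + cvec l)"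
    proof (cases "i = k")
      case True
      then have val: "u $ k + of_int (l $ k) = of_int (m + 1)"
        using m(2) by (simp add: algebra_simps)
      with assms m(1) have "m + 1 < 0" by (cases "m = -1") auto
      with val True show ?thesis unfolding in_nsupp_add_cvec_iff by blast
    qed (use m in \<open>auto simp: in_nsupp_add_cvec_iff axis_def\<close>)
  qed
  show "nsupp (u + cvec l) \<subseteq> nsupp (u + cvec (l - axis k 1))"
    using nsupp_add_cvec_antimono[of "l - axis k 1" _ l u] by (auto simp: axis_def)
qed

text \<open>\<open>gamma_quotient a k\<close> is \<open>\<Gamma>(a + 1) / \<Gamma>(a + k + 1)\<close> where this makes sense.\<close>

definition gamma_quotient :: "complex \<Rightarrow> int \<Rightarrow> complex" where
  "gamma_quotient a k = (\<Prod>j=1..nat (- k). a - of_nat j + 1) / (\<Prod>j=1..nat k. a + of_nat j)"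

lemma phi_coeff_eq_prod: "phi_coeff u l = (\<Prod>i\<in>UNIV. gamma_quotient (u $ i) (l $ i))"
proof -
  have "(\<Prod>i\<in>{i. l $ i < 0}. \<Prod>j=1..nat (- (l $ i)). u $ i - of_nat j + 1)
      = (\<Prod>i\<in>UNIV. \<Prod>j=1..nat (- (l $ i)). u $ i - of_nat j + 1)"
    by (rule prod.mono_neutral_left) auto
  moreover have "(\<Prod>i\<in>{i. l $ i > 0}. \<Prod>j=1..nat (l $ i). u $ i + of_nat j)
      = (\<Prod>i\<in>UNIV. \<Prod>j=1..nat (l $ i). u $ i + of_nat j)"
    by (rule prod.mono_neutral_left) auto
  ultimately show ?thesis
    unfolding phi_coeff_def gamma_quotient_def by (simp add: prod_dividef)
qed

lemma gamma_quotient_minus_1: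
  assumes "a + of_int k \<noteq> 0"
  shows "gamma_quotient a (k - 1) = (a + of_int k) * gamma_quotient a k"
proof (cases "k \<le> 0")
  case True
  define n where "n = nat (- k)"
  have k: "k = - int n" using True by (simp add: n_def)
  have "nat (- (k - 1)) = Suc n" "nat (- k) = n" "nat (k - 1) = 0" "nat k = 0" using k by auto
  then show ?thesis
    unfolding gamma_quotient_def using k by simp
next
  case False
  define n where "n = nat (k - 1)"
  have k: "k = int n + 1" using False by (simp add: n_def)
  have "nat (- (k - 1)) = 0" "nat (- k) = 0" "nat (k - 1) = n" "nat k = Suc n" using k by auto
  then show ?thesis
    unfolding gamma_quotient_def using k assms by (simp add: add_ac)
qed

lemma gamma_quotient_nonzero:
  assumes "(\<exists>m::int. m < 0 \<and> a = of_int m) \<longleftrightarrow> (\<exists>m::int. m < 0 \<and> a + of_int k = of_int m)"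
  shows "gamma_quotient a k \<noteq> 0"
proof (cases "\<exists>n. a = of_int n")
  case True
  then obtain n where n: "a = of_int n" by blast
  have "n < 0 \<longleftrightarrow> n + k < 0"
    using assms unfolding n of_int_add[symmetric] of_int_eq_iff by auto
  then have "n - int j + 1 \<noteq> 0" if "j \<in> {1..nat (- k)}" for j
    using that by auto
  moreover have "n + int j \<noteq> 0" if "j \<in> {1..nat k}" for j
    using that \<open>n < 0 \<longleftrightarrow> n + k < 0\<close> by auto
  moreover have "a - of_nat j + 1 = of_int (n - int j + 1)" "a + of_nat j = of_int (n + int j)" for j
    by (simp_all add: n)
  ultimately show ?thesis
    unfolding gamma_quotient_def by (simp del: of_int_add of_int_diff)
next
  case False
  have "a - of_nat j + 1 \<noteq> 0" "a + of_nat j \<noteq> 0" for j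
    using False[unfolded not_ex, rule_format, of "int j - 1"] False[unfolded not_ex, rule_format, of "- int j"]
    by (auto simp: algebra_simps eq_neg_iff_add_eq_0)
  then show ?thesis
    unfolding gamma_quotient_def by simp
qed

definition phi_coeff_ext :: "complex^'n::finite \<Rightarrow> int^'n \<Rightarrow> complex" where
  "phi_coeff_ext u l = (if nsupp (u + cvec l) = nsupp u then phi_coeff u l else 0)"

lemma phi_coeff_ext_eq_0_iff: "phi_coeff_ext u l = 0 \<longleftrightarrow> nsupp (u + cvec l) \<noteq> nsupp u"
proof -
  have "gamma_quotient (u $ i) (l $ i) \<noteq> 0" if "nsupp (u + cvec l) = nsupp u" for i
    using that in_nsupp_add_cvec_iff[of i u l] by (intro gamma_quotient_nonzero) (auto simp: nsupp_def)
  then show ?thesis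
    by (simp add: phi_coeff_ext_def phi_coeff_eq_prod)
qed

lemma phi_coeff_minus_axis:
  assumes "u $ k + of_int (l $ k) \<noteq> 0"
  shows "phi_coeff u (l - axis k 1) = (u $ k + of_int (l $ k)) * phi_coeff u l"
proof -
  have "phi_coeff u (l - axis k 1)
      = gamma_quotient (u $ k) (l $ k - 1) * (\<Prod>i\<in>UNIV - {k}. gamma_quotient (u $ i) ((l - axis k 1) $ i))"
    unfolding phi_coeff_eq_prod by (subst prod.remove[of _ k]) auto
  also have "(\<Prod>i\<in>UNIV - {k}. gamma_quotient (u $ i) ((l - axis k 1) $ i))
      = (\<Prod>i\<in>UNIV - {k}. gamma_quotient (u $ i) (l $ i))"
    by (rule prod.cong) (auto simp: axis_def)
  also have "gamma_quotient (u $ k) (l $ k - 1) * \<dots> = (u $ k + of_int (l $ k)) * phi_coeff u l"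
    unfolding phi_coeff_eq_prod gamma_quotient_minus_1[OF assms]
    by (subst prod.remove[of UNIV k "\<lambda>i. gamma_quotient (u $ i) (l $ i)"]) auto
  finally show ?thesis .
qed

lemma phi_coeff_ext_minus_axis:
  assumes "u $ k + of_int (l $ k) = 0 \<Longrightarrow> k \<in> nsupp u \<Longrightarrow> nsupp (u + cvec (l - axis k 1)) \<noteq> nsupp u"
  shows "phi_coeff_ext u (l - axis k 1) = (u $ k + of_int (l $ k)) * phi_coeff_ext u l"
proof (cases "u $ k + of_int (l $ k) = 0")
  case True
  then have "k \<in> nsupp (u + cvec (l - axis k 1))"
    unfolding in_nsupp_add_cvec_iff by (intro exI[of _ "-1"]) (simp add: algebra_simps)
  then have "nsupp (u + cvec (l - axis k 1)) \<noteq> nsupp u"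
    using assms True by auto
  then show ?thesis
    using True by (simp add: phi_coeff_ext_def)
next
  case False
  then show ?thesis
    using nsupp_minus_axis[OF False] phi_coeff_minus_axis[OF False] by (simp add: phi_coeff_ext_def)
qed

text \<open>Minimality of the negative support excludes the exceptional case of \<open>phi_coeff_ext_minus_axis\<close>.\<close>

lemma phi_coeff_ext_minus_int_vec_axis:
  assumes u: "min_nsupp A u" and l: "l \<in> int_kernel A"
  shows "phi_coeff_ext u (l - int_vec m - axis k 1)
    = (u + cvec (l - int_vec m)) $ k * phi_coeff_ext u (l - int_vec m)"
proof -
  have "phi_coeff_ext u (l - int_vec m - axis k 1)
      = (u $ k + of_int ((l - int_vec m) $ k)) * phi_coeff_ext u (l - int_vec m)"
  proof (rule phi_coeff_ext_minus_axis)
    assume zero: "u $ k + of_int ((l - int_vec m) $ k) = 0" and k: "k \<in> nsupp u"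
    show "nsupp (u + cvec (l - int_vec m - axis k 1)) \<noteq> nsupp u"
    proof
      assume "nsupp (u + cvec (l - int_vec m - axis k 1)) = nsupp u"
      then have "nsupp (u + cvec l) \<subseteq> nsupp u"
        using nsupp_add_cvec_antimono[of "l - int_vec m - axis k 1" _ l u] by (force simp: axis_def)
      then have "k \<in> nsupp (u + cvec l)"
        using u l k unfolding min_nsupp_def by blast
      then obtain n :: int where "n < 0" "u $ k + of_int (l $ k) = of_int n"
        unfolding in_nsupp_add_cvec_iff by blast
      moreover have "u $ k + of_int (l $ k) = of_int (int (m $ k))"
        using zero by (simp add: algebra_simps)
      ultimately show False by (metis of_int_eq_iff of_nat_less_0_iff)
    qed
  qed
  then show ?thesis by (simp add: cvec_def)
qed

definition phi_term :: "(complex^'n::finite \<Rightarrow> complex^'n) \<Rightarrow> complex^'n \<Rightarrow> int^'n \<Rightarrow> complex^'n \<Rightarrow> complex" where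
  "phi_term L u l x = phi_coeff_ext u l * monomial L (u + cvec l) x"

lemma normal_series_pd_phi_term:
  assumes u: "min_nsupp A u" and L: "log_branch L (ball q \<epsilon>)"
    and series: "normal_series (int_kernel A) (\<lambda>l. phi_term L u (l - int_vec m)) f q \<epsilon>"
  shows "normal_series (int_kernel A) (\<lambda>l. phi_term L u (l - int_vec (m + axis k 1))) (pd k f) q (\<epsilon> / 2)"
proof (rule normal_series_cong)
  show "normal_series (int_kernel A) (\<lambda>l x. (u + cvec (l - int_vec m)) $ k * phi_coeff_ext u (l - int_vec m)
      * monomial L (u + cvec (l - int_vec m) - axis k 1) x) (pd k f) q (\<epsilon> / 2)"
    by (rule normal_series_pd_monomial[OF L series[unfolded phi_term_def[abs_def]]])
  fix l x assume l: "l \<in> int_kernel A"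
  have "u + cvec (l - int_vec m) - axis k 1 = u + cvec (l - int_vec m - axis k 1)"
    by simp
  moreover have "l - int_vec m - axis k 1 = l - int_vec (m + axis k 1)"
    by (simp only: int_vec_add_axis diff_diff_eq)
  ultimately show "(u + cvec (l - int_vec m)) $ k * phi_coeff_ext u (l - int_vec m)
        * monomial L (u + cvec (l - int_vec m) - axis k 1) x
      = phi_term L u (l - int_vec (m + axis k 1)) x"
    by (simp only: phi_term_def phi_coeff_ext_minus_int_vec_axis[OF u l, symmetric])
qed simp

lemma normal_series_pd_monom:
  assumes u: "min_nsupp A u" and L: "log_branch L (ball q \<epsilon>)"
    and series: "normal_series (int_kernel A) (phi_term L u) f q \<epsilon>"
  shows "\<exists>\<epsilon>'\<in>{0<..\<epsilon>}. normal_series (int_kernel A) (\<lambda>l. phi_term L u (l - int_vec m)) (pd_monom m f) q \<epsilon>'"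
proof (induction m rule: nat_vec_induct)
  case zero
  have "\<epsilon> > 0" using series unfolding normal_series_def by blast
  then show ?case
    using series by (intro bexI[of _ \<epsilon>]) (simp_all add: int_vec_zero pd_monom_zero)
next
  case (add_axis m k)
  then obtain \<epsilon>' where \<epsilon>': "0 < \<epsilon>'" "\<epsilon>' \<le> \<epsilon>"
    and IH: "normal_series (int_kernel A) (\<lambda>l. phi_term L u (l - int_vec m)) (pd_monom m f) q \<epsilon>'"
    by auto
  have L': "log_branch L (ball q \<epsilon>')"
    using \<epsilon>' by (intro log_branch_subset[OF L] subset_ball)
  have "pd k (pd_monom m f) x = pd_monom (m + axis k 1) f x" if "x \<in> ball q (\<epsilon>' / 2)" for x
    using pd_monom_add_axis[OF normal_series_sep_holomorphic_on[OF series] open_ball] that \<epsilon>' by simp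
  then have "normal_series (int_kernel A) (\<lambda>l. phi_term L u (l - int_vec (m + axis k 1)))
      (pd_monom (m + axis k 1) f) q (\<epsilon>' / 2)"
    by (rule normal_series_cong[OF normal_series_pd_phi_term[OF u L' IH, of k] refl])
  then show ?case using \<epsilon>' by (intro bexI[of _ "\<epsilon>' / 2"]) auto
qed


section \<open>Normal convergence of Laurent series\<close>

definition laurent_weight :: "int^'n::finite \<Rightarrow> complex^'n \<Rightarrow> real" where
  "laurent_weight l x = (\<Prod>k\<in>UNIV. norm (x $ k) powi (l $ k))"

definition corner :: "complex^'n \<Rightarrow> real \<Rightarrow> 'n set \<Rightarrow> complex^'n" where
  "corner q \<theta> S = (\<chi> k. q $ k * of_real (if k \<in> S then \<theta> else inverse \<theta>))"

lemma laurent_weight_nonneg: "laurent_weight l x \<ge> 0"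
  by (simp add: laurent_weight_def prod_nonneg)

lemma norm_monomial_add_cvec:
  assumes "log_branch L U" "x \<in> U"
  shows "norm (monomial L (u + cvec l) x) = norm (monomial L u x) * laurent_weight l x"
  by (simp add: monomial_add_cvec[OF assms] laurent_weight_def norm_mult prod_norm[symmetric] norm_power_int)

lemma laurent_weight_le_sum_corners:
  assumes "\<theta> > 0" and q: "\<And>k. q $ k \<noteq> 0"
    and x: "\<And>k. norm (q $ k) * inverse \<theta> \<le> norm (x $ k) \<and> norm (x $ k) \<le> norm (q $ k) * \<theta>"
  shows "laurent_weight l x \<le> (\<Sum>S\<in>UNIV. laurent_weight l (corner q \<theta> S))"
proof -
  define S where "S = {k. l $ k \<ge> 0}"
  have "norm (x $ k) powi (l $ k) \<le> norm (corner q \<theta> S $ k) powi (l $ k)" for k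
  proof (cases "l $ k \<ge> 0")
    case True
    then show ?thesis
      using x[of k] \<open>\<theta> > 0\<close> by (intro power_int_mono) (auto simp: corner_def S_def norm_mult)
  next
    case False
    then show ?thesis
      using x[of k] q[of k] \<open>\<theta> > 0\<close>
      by (intro power_int_antimono) (auto simp: corner_def S_def norm_mult norm_inverse)
  qed
  then have "laurent_weight l x \<le> laurent_weight l (corner q \<theta> S)"
    unfolding laurent_weight_def by (intro prod_mono) auto
  also have "\<dots> \<le> (\<Sum>S\<in>UNIV. laurent_weight l (corner q \<theta> S))"
    by (rule member_le_sum) (auto simp: laurent_weight_nonneg)
  finally show ?thesis .
qed

lemma corners_in_open:
  assumes "open U" "q \<in> U"
  obtains \<theta> where "\<theta> > 1" "\<And>S. corner q \<theta> S \<in> U"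
proof -
  have "\<forall>\<^sub>F \<theta> in at_right 1. corner q \<theta> S \<in> U" for S
  proof (rule topological_tendstoD[OF _ assms(1)])
    have "((\<lambda>\<theta>. corner q \<theta> S) \<longlongrightarrow> corner q 1 S) (at_right 1)"
      unfolding corner_def by (intro tendsto_intros vec_tendstoI) (auto intro!: tendsto_eq_intros)
    moreover have "corner q 1 S = q"
      by (simp add: corner_def vec_eq_iff)
    ultimately show "((\<lambda>\<theta>. corner q \<theta> S) \<longlongrightarrow> q) (at_right 1)" by simp
    show "q \<in> U" by fact
  qed
  then have "\<forall>\<^sub>F \<theta> in at_right 1. \<forall>S. corner q \<theta> S \<in> U"
    by (rule eventually_all_finite)
  then have "\<forall>\<^sub>F \<theta> in at_right 1. \<theta> > 1 \<and> (\<forall>S. corner q \<theta> S \<in> U)"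
    using eventually_at_right_less by (rule eventually_conj[rotated])
  then show thesis
    using that eventually_happens'[OF trivial_limit_at_right_real] by blast
qed

lemma eventually_norm_nth_between:
  fixes q :: "complex^'n::finite"
  assumes "\<theta> > 1" "\<And>k. q $ k \<noteq> 0"
  shows "\<forall>\<^sub>F x in nhds q. \<forall>k. norm (q $ k) * inverse \<theta> \<le> norm (x $ k) \<and> norm (x $ k) \<le> norm (q $ k) * \<theta>"
proof (rule eventually_all_finite)
  fix k
  have lim: "((\<lambda>x. norm (x $ k)) \<longlongrightarrow> norm (q $ k)) (nhds q)"
    by (intro tendsto_intros filterlim_ident)
  have "norm (q $ k) * inverse \<theta> < norm (q $ k)" "norm (q $ k) < norm (q $ k) * \<theta>"
    using assms by (simp_all add: field_simps)
  from order_tendstoD(1)[OF lim this(1)] order_tendstoD(2)[OF lim this(2)]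
  show "\<forall>\<^sub>F x in nhds q. norm (q $ k) * inverse \<theta> \<le> norm (x $ k) \<and> norm (x $ k) \<le> norm (q $ k) * \<theta>"
    by eventually_elim simp
qed

lemma eventually_norm_monomial_less:
  assumes L: "log_branch L U" and "open U" "q \<in> U" and C: "norm (monomial L u q) < C"
  shows "\<forall>\<^sub>F x in nhds q. norm (monomial L u x) < C"
proof -
  have "isCont (monomial L u) q"
    using sep_holomorphic_on_monomial[OF L] assms(2,3)
    by (auto simp: sep_holomorphic_on_def continuous_on_eq_continuous_at)
  then have "((\<lambda>x. norm (monomial L u x)) \<longlongrightarrow> norm (monomial L u q)) (nhds q)"
    by (intro tendsto_norm) (simp add: isCont_def tendsto_at_iff_tendsto_nhds)
  then show ?thesis
    using C by (rule order_tendstoD)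
qed

text \<open>The weights \<open>|x\<^sup>l|\<close> near \<open>q\<close> are dominated by those at the corners
  \<open>(q\<^sub>k \<theta>\<^bsup>\<plusminus>1\<^esup>)\<^sub>k\<close>, where the series converges absolutely.\<close>

lemma norm_monomial_le_sum_corners:
  assumes L: "log_branch L U" and U: "open U" and q: "q \<in> U"
  obtains \<epsilon> \<theta> C where "\<epsilon> > 0" "ball q \<epsilon> \<subseteq> U" "\<And>S. corner q \<theta> S \<in> U"
    "\<And>x l. x \<in> ball q \<epsilon> \<Longrightarrow>
       norm (monomial L (u + cvec l) x) \<le> C * (\<Sum>S\<in>UNIV. laurent_weight l (corner q \<theta> S))"
proof -
  obtain \<theta> where \<theta>: "\<theta> > 1" and corners: "\<And>S. corner q \<theta> S \<in> U"
    using corners_in_open[OF U q] by blast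
  define C where "C = norm (monomial L u q) + 1"
  have "\<forall>\<^sub>F x in nhds q. (\<forall>k. norm (q $ k) * inverse \<theta> \<le> norm (x $ k) \<and> norm (x $ k) \<le> norm (q $ k) * \<theta>)
      \<and> norm (monomial L u x) < C \<and> x \<in> U"
    using eventually_norm_nth_between[OF \<theta> log_branch_nonzero[OF L q]]
      eventually_norm_monomial_less[OF L U q, of u C] eventually_nhds_in_open[OF U q]
    by (intro eventually_conj) (auto simp: C_def)
  then obtain \<epsilon> where \<epsilon>: "\<epsilon> > 0" and near: "\<And>x. x \<in> ball q \<epsilon> \<Longrightarrow>
      (\<forall>k. norm (q $ k) * inverse \<theta> \<le> norm (x $ k) \<and> norm (x $ k) \<le> norm (q $ k) * \<theta>)
      \<and> norm (monomial L u x) < C \<and> x \<in> U"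
    unfolding eventually_nhds_metric by (auto simp: dist_commute)
  have "norm (monomial L (u + cvec l) x) \<le> C * (\<Sum>S\<in>UNIV. laurent_weight l (corner q \<theta> S))"
    if x: "x \<in> ball q \<epsilon>" for x l
  proof -
    have "laurent_weight l x \<le> (\<Sum>S\<in>UNIV. laurent_weight l (corner q \<theta> S))"
      using near[OF x] \<theta> log_branch_nonzero[OF L q] by (intro laurent_weight_le_sum_corners) auto
    then have "norm (monomial L u x) * laurent_weight l x \<le> C * (\<Sum>S\<in>UNIV. laurent_weight l (corner q \<theta> S))"
      using near[OF x] by (intro mult_mono) (auto simp: C_def laurent_weight_nonneg)
    then show ?thesis
      using near[OF x] norm_monomial_add_cvec[OF L] by simp
  qed
  moreover have "ball q \<epsilon> \<subseteq> U" using near by blast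
  ultimately show thesis
    using that \<epsilon> corners by blast
qed

lemma has_sum_sum:
  fixes f :: "'i \<Rightarrow> 'a \<Rightarrow> 'b::{topological_comm_monoid_add}"
  assumes "\<And>i. i \<in> I \<Longrightarrow> (f i has_sum s i) S"
  shows "((\<lambda>x. \<Sum>i\<in>I. f i x) has_sum (\<Sum>i\<in>I. s i)) S"
  using assms by (induction I rule: infinite_finite_induct) (auto intro: has_sum_add)

lemma laurent_series_normal:
  assumes L: "log_branch L U" and U: "open U" and q: "q \<in> U"
    and series: "\<And>x. x \<in> U \<Longrightarrow> ((\<lambda>l. c l * monomial L (u + cvec l) x) has_sum f x) I"
  obtains \<epsilon> where "ball q \<epsilon> \<subseteq> U" "normal_series I (\<lambda>l x. c l * monomial L (u + cvec l) x) f q \<epsilon>"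
proof -
  obtain \<epsilon> \<theta> C where \<epsilon>: "\<epsilon> > 0" and sub: "ball q \<epsilon> \<subseteq> U" and corners: "\<And>S. corner q \<theta> S \<in> U"
    and bound: "\<And>x l. x \<in> ball q \<epsilon> \<Longrightarrow>
       norm (monomial L (u + cvec l) x) \<le> C * (\<Sum>S\<in>UNIV. laurent_weight l (corner q \<theta> S))"
    using norm_monomial_le_sum_corners[OF L U q, of u] by blast
  define M where "M l = C * (\<Sum>S\<in>UNIV. norm (c l) * laurent_weight l (corner q \<theta> S))" for l
  have "(\<lambda>l. norm (c l) * laurent_weight l x) summable_on I" if x: "x \<in> U" for x
  proof -
    have "(\<lambda>l. norm (c l * monomial L (u + cvec l) x)) summable_on I"
      using has_sum_imp_summable[OF series[OF x]] by (simp only: summable_on_iff_abs_summable_on_complex)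
    then have "(\<lambda>l. norm (monomial L u x) * (norm (c l) * laurent_weight l x)) summable_on I"
      by (simp add: norm_mult norm_monomial_add_cvec[OF L x] mult.left_commute)
    then show ?thesis
      using monomial_nonzero[of L u x] by (simp only: summable_on_cmult_right' norm_eq_zero not_False_eq_True)
  qed
  then have "((\<lambda>l. norm (c l) * laurent_weight l (corner q \<theta> S)) has_sum
      (\<Sum>\<^sub>\<infinity>l\<in>I. norm (c l) * laurent_weight l (corner q \<theta> S))) I" for S
    using corners by (intro has_sum_infsum) blast
  then have "M summable_on I"
    unfolding M_def[abs_def] by (intro summable_on_cmult_right has_sum_imp_summable[OF has_sum_sum])
  moreover have "norm (c l * monomial L (u + cvec l) x) \<le> M l" if "x \<in> ball q \<epsilon>" for l x
    using mult_left_mono[OF bound[OF that, of l] norm_ge_zero[of "c l"]]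
    by (simp add: norm_mult M_def mult.left_commute sum_distrib_left)
  moreover have "(\<lambda>x. c l * monomial L (u + cvec l) x) sep_holomorphic_on ball q \<epsilon>" for l
    by (intro sep_holomorphic_intros log_branch_subset[OF L sub])
  ultimately have "normal_series I (\<lambda>l x. c l * monomial L (u + cvec l) x) f q \<epsilon>"
    unfolding normal_series_def using \<epsilon> series sub by (intro conjI exI[of _ M]) auto
  then show thesis using that sub by blast
qed

lemma phi_sum_has_sum:
  assumes "phi_sum A u q f"
  obtains \<epsilon> L where "\<epsilon> > 0" "log_branch L (ball q \<epsilon>)"
    "\<And>x. x \<in> ball q \<epsilon> \<Longrightarrow> ((\<lambda>l. phi_term L u l x) has_sum f x) (int_kernel A)"
proof -
  obtain \<epsilon> L where \<epsilon>: "\<epsilon> > 0"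
    and hol: "\<And>j. (\<lambda>x. L x $ j) mholomorphic_on ball q \<epsilon>"
    and exp: "\<And>x j. x \<in> ball q \<epsilon> \<Longrightarrow> exp (L x $ j) = x $ j"
    and sum: "\<And>x. x \<in> ball q \<epsilon> \<Longrightarrow>
       ((\<lambda>l. phi_coeff u l * exp (\<Sum>j\<in>UNIV. (u + cvec l) $ j * L x $ j)) has_sum f x) (same_nsupp A u)"
    using assms unfolding phi_sum_def by (elim exE conjE) blast
  have "log_branch L (ball q \<epsilon>)"
    unfolding log_branch_def using hol exp mholomorphic_on_imp_sep_holomorphic_on by blast
  moreover have "((\<lambda>l. phi_term L u l x) has_sum f x) (int_kernel A) \<longleftrightarrow>
      ((\<lambda>l. phi_coeff u l * exp (\<Sum>j\<in>UNIV. (u + cvec l) $ j * L x $ j)) has_sum f x) (same_nsupp A u)" for x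
    by (rule has_sum_cong_neutral)
      (auto simp: same_nsupp_def int_kernel_def phi_term_def phi_coeff_ext_def monomial_def)
  ultimately show thesis
    using that \<epsilon> sum by blast
qed

lemma phi_converges_imp_log_branch:
  assumes "phi_converges A u p"
  obtains L V where "log_branch L V" "open V" "p \<in> V"
  using assms unfolding phi_converges_def by (elim exE phi_sum_has_sum) (auto intro: that[of _ "ball p _"])

lemma phi_sum_normal_series:
  assumes "phi_sum A u q f"
  obtains \<epsilon> L where "log_branch L (ball q \<epsilon>)"
    "normal_series (int_kernel A) (phi_term L u) f q \<epsilon>"
proof -
  obtain \<epsilon> L where \<epsilon>: "\<epsilon> > 0" and L: "log_branch L (ball q \<epsilon>)"
    and sum: "\<And>x. x \<in> ball q \<epsilon> \<Longrightarrow>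
      ((\<lambda>l. phi_term L u l x) has_sum f x) (int_kernel A)"
    by (rule phi_sum_has_sum[OF assms]) (rule that)
  have "q \<in> ball q \<epsilon>" using \<epsilon> by simp
  then obtain \<epsilon>' where "ball q \<epsilon>' \<subseteq> ball q \<epsilon>"
    "normal_series (int_kernel A) (phi_term L u) f q \<epsilon>'"
    using laurent_series_normal[OF L open_ball _ sum[unfolded phi_term_def]]
    unfolding phi_term_def[abs_def] by blast
  then show thesis
    using that log_branch_subset[OF L] by blast
qed

lemma phi_sum_pd_monom_has_sum:
  assumes u: "min_nsupp A u" and \<phi>: "phi_sum A u q f"
  obtains \<epsilon> L where "\<epsilon> > 0" "log_branch L (ball q \<epsilon>)" "\<And>m. \<forall>\<^sub>F x in nhds q.
    ((\<lambda>l. phi_term L u (l - int_vec m) x)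
      has_sum pd_monom m f x) (int_kernel A)"
proof -
  obtain \<epsilon> L where L: "log_branch L (ball q \<epsilon>)"
    and series: "normal_series (int_kernel A) (phi_term L u) f q \<epsilon>"
    by (rule phi_sum_normal_series[OF \<phi>]) (rule that)
  have "\<epsilon> > 0" using series unfolding normal_series_def by blast
  moreover have "\<forall>\<^sub>F x in nhds q. ((\<lambda>l. phi_term L u (l - int_vec m) x)
      has_sum pd_monom m f x) (int_kernel A)" for m
  proof -
    obtain \<epsilon>' where \<epsilon>': "\<epsilon>' > 0" "normal_series (int_kernel A)
       (\<lambda>l. phi_term L u (l - int_vec m)) (pd_monom m f) q \<epsilon>'"
      using normal_series_pd_monom[OF u L series, of m] by force
    have "\<forall>\<^sub>F x in nhds q. x \<in> ball q \<epsilon>'"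
      using \<epsilon>'(1) by (intro eventually_nhds_in_open) auto
    then show ?thesis
      using \<epsilon>'(2) unfolding normal_series_def by (auto elim: eventually_mono)
  qed
  ultimately show thesis
    using that L by blast
qed


section \<open>Solutions of A-hypergeometric systems\<close>

lemma solutions_imp_sep_holomorphic_on: "\<psi> \<in> solutions U A \<beta> \<Longrightarrow> \<psi> sep_holomorphic_on U"
  unfolding solutions_def by (blast intro: mholomorphic_on_imp_sep_holomorphic_on)

lemma sep_holomorphic_on_pd_map:
  assumes "f sep_holomorphic_on U" "open U"
  shows "pd_map U k f sep_holomorphic_on U"
  by (rule sep_holomorphic_on_cong[OF sep_holomorphic_on_pd[OF assms]]) (use assms in \<open>auto simp: pd_map_def\<close>)

lemma solutions_toric:
  assumes \<psi>: "\<psi> \<in> solutions U A \<beta>" and x: "x \<in> U" and eq: "A *v int_vec u = A *v int_vec u'"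
  shows "pd_monom u \<psi> x = pd_monom u' \<psi> x"
proof -
  have "(\<lambda>f x. pd_monom u f x - pd_monom u' f x) \<in> hypergeometric_ideal A \<beta>"
    using eq unfolding int_vec_def by (rule hypergeometric_ideal.toric)
  then show ?thesis
    using \<psi> x unfolding solutions_def by fastforce
qed

lemma sum_mult_matrix_vector:
  fixes M :: "'a::comm_semiring_1^'n::finite^'m::finite"
  shows "(\<Sum>i\<in>UNIV. w $ i * (M *v u) $ i) = (\<Sum>k\<in>UNIV. (w v* M) $ k * u $ k)"
  unfolding matrix_vector_mult_def vector_matrix_mult_def
  by (simp add: sum_distrib_left sum_distrib_right mult_ac) (rule sum.swap)

lemma cvec_vector_matrix_mult: "cvec (y v* A) = cvec y v* map_matrix of_int A"
  by (simp add: cvec_def vector_matrix_mult_def map_matrix_def)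

lemma solutions_euler:
  assumes \<psi>: "\<psi> \<in> solutions U A (map_matrix of_int A *v v)" and x: "x \<in> U"
  shows "euler_op (cvec (y v* A)) \<psi> x = (\<Sum>k\<in>UNIV. cvec (y v* A) $ k * v $ k) * \<psi> x"
proof -
  define z where "z = (\<chi> k. x $ k * pd k \<psi> x)"
  have "(map_matrix of_int A *v z) $ i = (map_matrix of_int A *v v) $ i * \<psi> x" for i
  proof -
    have "(\<Sum>j\<in>UNIV. of_int (A $ i $ j) * x $ j * pd j \<psi> x) - (map_matrix of_int A *v v) $ i * \<psi> x = 0"
      using \<psi> x hypergeometric_ideal.euler[of A i "map_matrix of_int A *v v"]
      unfolding solutions_def by fastforce
    then show ?thesis
      by (simp add: z_def matrix_vector_mult_def map_matrix_def mult.assoc)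
  qed
  then have "(\<Sum>i\<in>UNIV. cvec y $ i * (map_matrix of_int A *v z) $ i)
      = (\<Sum>i\<in>UNIV. cvec y $ i * (map_matrix of_int A *v v) $ i) * \<psi> x"
    by (simp add: sum_distrib_right mult.assoc)
  then show ?thesis
    unfolding sum_mult_matrix_vector cvec_vector_matrix_mult by (simp add: z_def euler_op_def)
qed

lemma kernel_orthogonal_imp_in_row_space:
  fixes A :: "'a::comm_ring_1^'n::finite^'d::finite"
  assumes surj: "\<And>y. \<exists>u. A *v u = y"
    and orth: "\<And>l. A *v l = 0 \<Longrightarrow> (\<Sum>k\<in>UNIV. w $ k * l $ k) = 0"
  obtains y where "w = y v* A"
proof -
  obtain s where s: "\<And>y. A *v s y = y"
    using surj by metis
  define S where "S = (\<chi> k i. s (axis i 1) $ k)"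
  have "A ** S = mat 1"
  proof -
    have "(A ** S) $ i $ j = (A *v s (axis j 1)) $ i" for i j
      by (simp add: S_def matrix_matrix_mult_def matrix_vector_mult_def)
    then show ?thesis
      by (simp add: s vec_eq_iff mat_def axis_def)
  qed
  then have "A *v (u - S *v (A *v u)) = 0" for u
    by (simp add: matrix_vector_mult_diff_distrib matrix_vector_mul_assoc matrix_mul_assoc)
  then have "(\<Sum>k\<in>UNIV. w $ k * u $ k) = (\<Sum>k\<in>UNIV. w $ k * (S *v (A *v u)) $ k)" for u
    using orth[of "u - S *v (A *v u)"] by (simp add: right_diff_distrib sum_subtractf)
  then have eq: "(\<Sum>k\<in>UNIV. w $ k * u $ k) = (\<Sum>k\<in>UNIV. (w v* S v* A) $ k * u $ k)" for u
    by (simp add: sum_mult_matrix_vector)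
  have "w $ k = (w v* S v* A) $ k" for k
    using eq[of "axis k 1"] by (simp add: axis_def if_distrib cong: if_cong)
  then have "w = w v* S v* A"
    by (simp add: vec_eq_iff)
  then show thesis by (rule that)
qed


section \<open>Linear independence modulo a subspace\<close>

locale vector_space_modulo = vector_space scale
  for scale :: "'a::field \<Rightarrow> 'b::ab_group_add \<Rightarrow> 'b" (infixr \<open>\<odot>\<close> 75) +
  fixes W :: "'b set"
begin

definition independent_family :: "('i \<Rightarrow> 'b) \<Rightarrow> 'i set \<Rightarrow> bool" where
  "independent_family \<psi> I \<longleftrightarrow>
     finite I \<and> (\<forall>c. (\<Sum>i\<in>I. c i \<odot> \<psi> i) \<in> span W \<longrightarrow> (\<forall>i\<in>I. c i = 0))"

lemma independent_familyI_subspaces: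
  assumes "finite I"
    and K: "\<And>i. i \<in> I \<Longrightarrow> subspace (K i)" "\<And>i. i \<in> I \<Longrightarrow> W \<subseteq> K i"
    and \<psi>: "\<And>i j. i \<in> I \<Longrightarrow> j \<in> I \<Longrightarrow> \<psi> j \<in> K i \<longleftrightarrow> j \<noteq> i"
  shows "independent_family \<psi> I"
  unfolding independent_family_def
proof (intro conjI allI impI ballI)
  fix c i assume sum: "(\<Sum>i\<in>I. c i \<odot> \<psi> i) \<in> span W" and i: "i \<in> I"
  have "(\<Sum>i\<in>I. c i \<odot> \<psi> i) - (\<Sum>j\<in>I - {i}. c j \<odot> \<psi> j) \<in> K i"
  proof (rule subspace_diff[OF K(1)[OF i]])
    show "(\<Sum>i\<in>I. c i \<odot> \<psi> i) \<in> K i"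
      using span_minimal[OF K(2) K(1)] i sum by blast
    show "(\<Sum>j\<in>I - {i}. c j \<odot> \<psi> j) \<in> K i"
      using i \<psi>[OF i] by (intro subspace_sum subspace_scale K(1)) auto
  qed
  then have "c i \<odot> \<psi> i \<in> K i"
    using \<open>finite I\<close> i by (simp add: sum_diff1)
  then have "\<psi> i \<in> K i" if "c i \<noteq> 0"
    using subspace_scale[OF K(1)[OF i], of "c i \<odot> \<psi> i" "inverse (c i)"] that by simp
  then show "c i = 0"
    using \<psi>[OF i i] by blast
qed fact

lemma independent_family_pairD:
  assumes "independent_family \<psi> {i, j}" "i \<noteq> j" "a \<odot> \<psi> i + b \<odot> \<psi> j \<in> W"
  shows "a = 0 \<and> b = 0"
proof -
  define c where "c k = (if k = i then a else b)" for k
  have "(\<Sum>k\<in>{i, j}. c k \<odot> \<psi> k) \<in> span W"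
    using assms(2,3) by (simp add: c_def span_base)
  then have "c i = 0 \<and> c j = 0"
    using assms(1) by (simp add: independent_family_def)
  then show ?thesis
    using assms(2) by (simp add: c_def)
qed

lemma card_le_of_scalars_zero:
  assumes "finite I" "finite T" and span: "\<And>i. i \<in> I \<Longrightarrow> \<tau> i \<in> span T"
    and zero: "\<And>c i. (\<Sum>i\<in>I. c i \<odot> \<tau> i) = 0 \<Longrightarrow> i \<in> I \<Longrightarrow> c i = 0"
  shows "card I \<le> card T"
proof -
  have inj: "inj_on \<tau> I"
  proof (rule inj_onI, rule ccontr)
    fix i j assume ij: "i \<in> I" "j \<in> I" "\<tau> i = \<tau> j" "i \<noteq> j"
    define c where "c k = (if k = i then 1 else if k = j then - 1 else 0 :: 'a)" for k
    have "(\<Sum>k\<in>I. c k \<odot> \<tau> k) = (\<Sum>k\<in>{i, j}. c k \<odot> \<tau> k)"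
      using \<open>finite I\<close> ij by (intro sum.mono_neutral_right) (auto simp: c_def)
    also have "\<dots> = 0"
      using ij by (simp add: c_def)
    finally show False
      using zero[of c i] ij by (simp add: c_def)
  qed
  have "independent (\<tau> ` I)"
  proof (rule independent_if_scalars_zero)
    fix c t assume "(\<Sum>t\<in>\<tau> ` I. c t \<odot> t) = 0" and t: "t \<in> \<tau> ` I"
    then have "(\<Sum>i\<in>I. c (\<tau> i) \<odot> \<tau> i) = 0"
      by (simp add: sum.reindex[OF inj])
    then show "c t = 0" using zero[of "\<lambda>i. c (\<tau> i)"] t by blast
  qed (simp add: \<open>finite I\<close>)
  then have "card (\<tau> ` I) \<le> card T"
    using independent_span_bound[OF \<open>finite T\<close>] span by blast
  then show ?thesis by (simp add: card_image[OF inj])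
qed

lemma independent_family_card_le:
  assumes indep: "independent_family \<psi> I" and T: "finite T"
    and span: "\<And>i. i \<in> I \<Longrightarrow> \<psi> i \<in> span (T \<union> W)"
  shows "card I \<le> card T"
proof -
  have "\<exists>t. t \<in> span T \<and> \<psi> i - t \<in> span W" if "i \<in> I" for i
    using span[OF that] unfolding span_Un by force
  then obtain \<tau> where \<tau>: "\<And>i. i \<in> I \<Longrightarrow> \<tau> i \<in> span T" "\<And>i. i \<in> I \<Longrightarrow> \<psi> i - \<tau> i \<in> span W"
    by metis
  show ?thesis
  proof (rule card_le_of_scalars_zero[OF _ T \<tau>(1)])
    fix c i assume c: "(\<Sum>i\<in>I. c i \<odot> \<tau> i) = 0" and i: "i \<in> I"
    have "(\<Sum>i\<in>I. c i \<odot> (\<psi> i - \<tau> i)) \<in> span W"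
      by (intro span_sum span_scale \<tau>(2))
    then have "(\<Sum>i\<in>I. c i \<odot> \<psi> i) \<in> span W"
      using c by (simp add: scale_right_diff_distrib sum_subtractf)
    then show "c i = 0"
      using indep i unfolding independent_family_def by blast
  qed (use indep in \<open>auto simp: independent_family_def\<close>)
qed

lemma dim_Int_span_add_card_le:
  assumes indep: "independent_family \<psi> I" and \<Phi>: "finite \<Phi>"
    and \<psi>: "\<And>i. i \<in> I \<Longrightarrow> \<psi> i \<in> span \<Phi>"
  shows "dim (W \<inter> span \<Phi>) + card I \<le> card \<Phi>"
proof -
  obtain C where C: "C \<subseteq> W \<inter> span \<Phi>" "independent C" "card C = dim (W \<inter> span \<Phi>)"
    by (rule basis_exists[of "W \<inter> span \<Phi>"])
  then obtain D where D: "C \<subseteq> D" "D \<subseteq> span \<Phi>" "independent D" "span \<Phi> \<subseteq> span D"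
    using maximal_independent_subset_extend[of C "span \<Phi>"] by blast
  have card_D: "finite D" "card D \<le> card \<Phi>"
    using independent_span_bound[OF \<Phi> D(3,2)] by auto
  have "card I \<le> card (D - C)"
  proof (rule independent_family_card_le[OF indep])
    show "\<psi> i \<in> span ((D - C) \<union> W)" if "i \<in> I" for i
      using span_mono[of D "(D - C) \<union> W"] C(1) D(4) \<psi>[OF that] by blast
  qed (use card_D in simp)
  also have "\<dots> = card D - card C"
    using D(1) card_D(1) by (meson card_Diff_subset finite_subset)
  finally show ?thesis
    using C(3) card_D card_mono[OF card_D(1) D(1)] by linarith
qed

end

global_interpretation cfun_modulo: vector_space_modulo cscale W
  for W :: "('a \<Rightarrow> complex) set"
  by unfold_locales

lemma card_le_dim_mod:
  assumes indep: "cfun_modulo.independent_family W \<psi> I" and \<Phi>: "finite \<Phi>"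
    and \<psi>: "\<And>i. i \<in> I \<Longrightarrow> \<psi> i \<in> cfun.span \<Phi>"
  shows "card I \<le> dim_mod (cfun.span \<Phi>) W"
proof -
  define generates where "generates T \<longleftrightarrow>
    finite T \<and> T \<subseteq> cfun.span \<Phi> \<and> cfun.span \<Phi> \<subseteq> cfun.span (T \<union> W)" for T
  have dim_mod: "dim_mod (cfun.span \<Phi>) W = (LEAST k. \<exists>T. card T = k \<and> generates T)"
    unfolding dim_mod_def generates_def by (intro arg_cong[where f = Least] ext) blast
  have "generates \<Phi>"
    unfolding generates_def using \<Phi> by (auto intro: cfun.span_base subsetD[OF cfun.span_mono])
  then obtain T where T: "card T = dim_mod (cfun.span \<Phi>) W" "generates T"
    unfolding dim_mod using LeastI[of "\<lambda>k. \<exists>T. card T = k \<and> generates T"] by blast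
  have "card I \<le> card T"
    using T(2) \<psi> by (intro cfun_modulo.independent_family_card_le[OF indep]) (auto simp: generates_def)
  then show ?thesis
    by (simp add: T(1))
qed


section \<open>The annihilating operators\<close>

lemma add_of_int_notin_Rats_neq: "a \<notin> \<rat> \<Longrightarrow> a + of_int n \<noteq> (of_int m :: complex)"
  by (metis Rats_diff Rats_of_int add_diff_cancel_right')

locale quadrant_rows =
  fixes A :: "int^'n::finite^'d::finite" and B :: "int^2^'n" and j1 j2 j3 j4 :: 'n and \<alpha> :: "complex^'n"
  assumes surj: "\<And>y. \<exists>u. A *v u = y"
    and basis: "bij_betw (\<lambda>z. B *v z) UNIV {u. A *v u = 0}"
    and indices: "distinct [j1, j2, j3, j4]"
    and row1: "B $ j1 $ 1 > 0" "B $ j1 $ 2 > 0"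
    and row2: "B $ j2 $ 1 < 0" "B $ j2 $ 2 > 0"
    and row3: "B $ j3 $ 1 < 0" "B $ j3 $ 2 < 0"
    and row4: "B $ j4 $ 1 > 0" "B $ j4 $ 2 < 0"
    and irrational: "\<And>i. i \<notin> {j1, j2, j3, j4} \<Longrightarrow> \<alpha> $ i \<notin> \<rat>"
begin

definition J :: "'n set" where "J = {j1, j2, j3, j4}"

text \<open>The exponent of \<open>\<phi>\<^sub>i\<close> is \<open>v - e\<^sub>3 - shift i\<close>, and the \<open>y\<close>, \<open>M\<close>, \<open>m\<^sub>i\<close> of the proof idea above are
  \<open>generic_part\<close>, \<open>common_monom\<close>, \<open>monom_of i\<close>; so \<open>v = y + M\<close> and \<open>m\<^sub>i + e\<^sub>3 = M + e\<^sub>i - shift i\<close>.\<close>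

definition generic_part :: "complex^'n" where
  "generic_part = (\<chi> i. if i \<in> J then 0 else \<alpha> $ i)"

definition base :: "int^'n" where
  "base = pos_part (column 1 B) + pos_part (column 2 B) - (\<Sum>i\<in>J. axis i 1)"

definition shift :: "'n \<Rightarrow> int^'n" where
  "shift i = (if i = j1 then column 1 B + column 2 B else if i = j2 then column 2 B
              else if i = j4 then column 1 B else 0)"

definition phi_exponent :: "'n \<Rightarrow> complex^'n" where
  "phi_exponent i = generic_part + cvec (base - shift i)"

definition common_monom :: "nat^'n" where
  "common_monom = (\<chi> k. nat ((base + axis j3 1) $ k))"

definition monom_of :: "'n \<Rightarrow> nat^'n" where
  "monom_of i = (\<chi> k. nat ((base - shift i + axis i 1) $ k))"

definition row_dependences :: "(int^'n) set" where
  "row_dependences = {w. (\<forall>i. i \<notin> J \<longrightarrow> w $ i = 0) \<and> w v* B = 0}"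

definition annihilator :: "int^'n \<Rightarrow> (complex^'n \<Rightarrow> complex) \<Rightarrow> complex^'n \<Rightarrow> complex" where
  "annihilator w f x = (\<Sum>i\<in>J. of_int (w $ i) * (x $ i * pd_monom (monom_of i) f x))"

lemma distinct_indices: "j1 \<noteq> j2" "j1 \<noteq> j3" "j1 \<noteq> j4" "j2 \<noteq> j3" "j2 \<noteq> j4" "j3 \<noteq> j4"
  "j2 \<noteq> j1" "j3 \<noteq> j1" "j4 \<noteq> j1" "j3 \<noteq> j2" "j4 \<noteq> j2" "j4 \<noteq> j3"
  using indices by auto

lemma finite_J [simp]: "finite J"
  by (simp add: J_def)

lemma in_J: "j1 \<in> J" "j2 \<in> J" "j3 \<in> J" "j4 \<in> J"
  by (simp_all add: J_def)

lemma weyl_annihilator: "annihilator w \<in> weyl"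
  unfolding annihilator_def[abs_def]
  by (intro weyl_sum weyl_cmult weyl_coordinate_mult weyl_pd_monom)

lemma int_kernel_eq_range: "int_kernel A = range ((*v) B)"
  using bij_betw_imp_surj_on[OF basis] unfolding int_kernel_def by blast

lemma shift_in_int_kernel: "shift i \<in> int_kernel A"
proof -
  have "column c B = B *v axis c 1" for c
    by (simp add: vec_eq_iff column_def matrix_vector_mult_def axis_def if_distrib cong: if_cong)
  then have "column c B \<in> int_kernel A" for c
    unfolding int_kernel_eq_range by blast
  then show ?thesis
    by (simp add: shift_def int_kernel_add int_kernel_zero)
qed

lemma base_nth: "base $ k = max (B $ k $ 1) 0 + max (B $ k $ 2) 0 - (if k \<in> J then 1 else 0)"
proof -
  have "(\<Sum>i\<in>J. axis i (1::int)) $ k = (\<Sum>i\<in>J. if i = k then 1 else 0)"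
    unfolding sum_component by (intro sum.cong) (auto simp: axis_def)
  then show ?thesis
    by (simp add: base_def pos_part_def column_def)
qed

lemma base_minus_shift_nth_self: "i \<in> J \<Longrightarrow> (base - shift i) $ i = - 1"
  using row1 row2 row3 row4 distinct_indices
  by (auto simp: base_nth shift_def column_def J_def)

lemma base_minus_shift_nth_other: "i \<in> J \<Longrightarrow> k \<noteq> i \<Longrightarrow> (base - shift i) $ k \<ge> 0"
  using row1 row2 row3 row4 distinct_indices
  by (auto simp: base_nth shift_def column_def J_def)

lemma int_vec_common_monom: "int_vec common_monom = base + axis j3 1"
proof -
  have "(base + axis j3 1) $ k \<ge> 0" for k
    using base_minus_shift_nth_self[OF in_J(3)] base_minus_shift_nth_other[OF in_J(3), of k] distinct_indices
    by (cases "k = j3") (auto simp: shift_def axis_def)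
  then show ?thesis by (simp add: common_monom_def vec_eq_iff)
qed

lemma int_vec_monom_of: "i \<in> J \<Longrightarrow> int_vec (monom_of i) = base - shift i + axis i 1"
proof -
  assume i: "i \<in> J"
  have "(base - shift i + axis i 1) $ k \<ge> 0" for k
    using base_minus_shift_nth_self[OF i] base_minus_shift_nth_other[OF i, of k]
    by (cases "k = i") (auto simp: axis_def)
  then show ?thesis by (simp add: monom_of_def vec_eq_iff)
qed

lemma opposite_row:
  obtains i where "i \<in> J"
    "\<And>c. B $ i $ c > 0 \<and> z $ c \<le> -1 \<or> B $ i $ c < 0 \<and> (z :: int^2) $ c \<ge> 0"
proof -
  consider "z $ 1 \<ge> 0" "z $ 2 \<ge> 0" | "z $ 1 \<le> -1" "z $ 2 \<le> -1"
    | "z $ 1 \<le> -1" "z $ 2 \<ge> 0" | "z $ 1 \<ge> 0" "z $ 2 \<le> -1"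
    by linarith
  then have "\<exists>i\<in>J. \<forall>c. B $ i $ c > 0 \<and> z $ c \<le> -1 \<or> B $ i $ c < 0 \<and> z $ c \<ge> 0"
    unfolding forall_2 J_def using row1 row2 row3 row4 by cases auto
  then show thesis using that by blast
qed

lemma int_kernel_nonneg_imp_zero:
  assumes l: "l \<in> int_kernel A" and nonneg: "\<And>i. i \<in> J \<Longrightarrow> l $ i \<ge> 0"
  shows "l = 0"
proof -
  obtain z where z: "l = B *v z" using l unfolding int_kernel_eq_range by blast
  obtain i where i: "i \<in> J"
    and opposite: "\<And>c. B $ i $ c > 0 \<and> z $ c \<le> -1 \<or> B $ i $ c < 0 \<and> z $ c \<ge> 0"
    using opposite_row[of z] by blast
  have nonpos: "B $ i $ c * z $ c \<le> 0" for c
    using opposite[of c] by (auto intro: mult_nonneg_nonpos mult_nonpos_nonneg)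
  have "B $ i $ 1 * z $ 1 + B $ i $ 2 * z $ 2 \<ge> 0"
    using nonneg[OF i] by (simp add: z matrix_vector_mult_def sum_2)
  then have "B $ i $ 1 * z $ 1 = 0 \<and> B $ i $ 2 * z $ 2 = 0"
    using nonpos[of 1] nonpos[of 2] by linarith
  then have "z = 0"
    unfolding vec_eq_iff forall_2 using opposite[of 1] opposite[of 2] by auto
  then show ?thesis
    by (simp add: z)
qed

lemma base_add_int_kernel_negative:
  assumes "l \<in> int_kernel A"
  obtains i where "i \<in> J" "(base + l) $ i < 0"
proof -
  obtain z where z: "l = B *v z" using assms unfolding int_kernel_eq_range by blast
  obtain i where i: "i \<in> J"
    and opposite: "\<And>c. B $ i $ c > 0 \<and> z $ c \<le> -1 \<or> B $ i $ c < 0 \<and> z $ c \<ge> 0"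
    using opposite_row[of z] by blast
  have "max (B $ i $ c) 0 + B $ i $ c * z $ c \<le> 0" for c
  proof (cases "B $ i $ c > 0")
    case True
    then have "B $ i $ c * (1 + z $ c) \<le> 0"
      using opposite[of c] by (intro mult_nonneg_nonpos) auto
    with True show ?thesis by (simp add: distrib_left)
  qed (use opposite[of c] in \<open>auto intro: mult_nonpos_nonneg\<close>)
  from this[of 1] this[of 2] have "(base + l) $ i < 0"
    using i by (simp add: base_nth z matrix_vector_mult_def sum_2)
  with i show thesis by (rule that)
qed

lemma nsupp_generic_part_add: "nsupp (generic_part + cvec l) = {i \<in> J. l $ i < 0}"
proof (rule set_eqI)
  fix i
  show "i \<in> nsupp (generic_part + cvec l) \<longleftrightarrow> i \<in> {i \<in> J. l $ i < 0}"
  proof (cases "i \<in> J")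
    case False
    then have "\<alpha> $ i + of_int (l $ i) \<noteq> of_int m" for m
      using irrational[of i] add_of_int_notin_Rats_neq by (simp add: J_def)
    with False show ?thesis by (simp add: in_nsupp_add_cvec_iff generic_part_def)
  qed (simp add: in_nsupp_add_cvec_iff generic_part_def)
qed

lemma nsupp_phi_exponent: "i \<in> J \<Longrightarrow> nsupp (phi_exponent i) = {i}"
  unfolding phi_exponent_def nsupp_generic_part_add
  using base_minus_shift_nth_self base_minus_shift_nth_other by fastforce

lemma min_nsupp_phi_exponent:
  assumes i: "i \<in> J"
  shows "min_nsupp A (phi_exponent i)"
  unfolding min_nsupp_def
proof (intro ballI impI)
  fix l assume l: "l \<in> int_kernel A" and sub: "nsupp (phi_exponent i + cvec l) \<subseteq> nsupp (phi_exponent i)"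
  obtain k where k: "k \<in> J" "(base + (l - shift i)) $ k < 0"
    using base_add_int_kernel_negative int_kernel_diff[OF l shift_in_int_kernel] by metis
  have "phi_exponent i + cvec l = generic_part + cvec (base + (l - shift i))"
    by (simp add: phi_exponent_def)
  then have "k \<in> nsupp (phi_exponent i + cvec l)"
    using k by (simp only: nsupp_generic_part_add mem_Collect_eq)
  then show "nsupp (phi_exponent i + cvec l) = nsupp (phi_exponent i)"
    using sub unfolding nsupp_phi_exponent[OF i] by blast
qed

lemma row_dependence_orthogonal:
  assumes "w \<in> row_dependences" "l \<in> int_kernel A"
  shows "(\<Sum>k\<in>UNIV. w $ k * l $ k) = 0"
proof -
  obtain z where "l = B *v z" using assms(2) unfolding int_kernel_eq_range by blast
  then show ?thesis
    using assms(1) by (simp add: sum_mult_matrix_vector row_dependences_def)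
qed

lemma sum_row_dependence:
  assumes "w \<in> row_dependences"
  shows "(\<Sum>i\<in>J. of_int (w $ i) * (f i :: complex)) = (\<Sum>k\<in>UNIV. of_int (w $ k) * f k)"
  by (rule sum.mono_neutral_left) (use assms in \<open>auto simp: row_dependences_def\<close>)

lemma solutions_monom_of_pd:
  assumes \<psi>: "\<psi> \<in> solutions U A \<beta>" and U: "open U" and x: "x \<in> U" and i: "i \<in> J"
  shows "pd_monom (monom_of i) (pd j3 \<psi>) x = pd i (pd_monom common_monom \<psi>) x"
proof -
  note hol = solutions_imp_sep_holomorphic_on[OF \<psi>]
  have "int_vec (common_monom + axis i 1) - int_vec (monom_of i + axis j3 1) = shift i"
    unfolding int_vec_add_axis int_vec_monom_of[OF i] int_vec_common_monom by simp
  then have "A *v int_vec (common_monom + axis i 1) - A *v int_vec (monom_of i + axis j3 1) = 0"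
    using shift_in_int_kernel[of i] by (simp add: int_kernel_def flip: matrix_vector_mult_diff_distrib)
  then have "pd_monom (common_monom + axis i 1) \<psi> x = pd_monom (monom_of i + axis j3 1) \<psi> x"
    by (intro solutions_toric[OF \<psi> x]) simp
  then show ?thesis
    unfolding pd_monom_add_axis[OF hol U x] pd_monom_commute[OF hol U x] by simp
qed

lemma annihilator_pd_map:
  assumes w: "w \<in> row_dependences" and U: "open U" and x: "x \<in> U"
    and \<psi>: "\<psi> \<in> solutions U A (map_matrix of_int A *v (generic_part + cvec (base + axis j3 1)))"
  shows "annihilator w (pd_map U j3 \<psi>) x = 0"
proof -
  obtain y where y: "w = y v* A"
    using row_dependence_orthogonal[OF w] kernel_orthogonal_imp_in_row_space[OF surj]
    unfolding int_kernel_def by blast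
  have "annihilator w (pd_map U j3 \<psi>) x = annihilator w (pd j3 \<psi>) x"
    by (rule weyl_cong[OF weyl_annihilator U _ x]) (simp add: pd_map_def)
  also have "\<dots> = (\<Sum>i\<in>J. of_int (w $ i) * (x $ i * pd i (pd_monom common_monom \<psi>) x))"
    unfolding annihilator_def by (rule sum.cong) (simp_all add: solutions_monom_of_pd[OF \<psi> U x])
  also have "\<dots> = euler_op (cvec w) (pd_monom common_monom \<psi>) x"
    by (simp add: sum_row_dependence[OF w] euler_op_def cvec_def)
  also have "\<dots> = ((\<Sum>k\<in>UNIV. cvec w $ k * (generic_part + cvec (int_vec common_monom)) $ k)
      - (\<Sum>k\<in>UNIV. cvec w $ k * of_nat (common_monom $ k))) * pd_monom common_monom \<psi> x"
    using solutions_euler[OF \<psi>, of _ y]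
    by (intro euler_op_pd_monom[OF solutions_imp_sep_holomorphic_on[OF \<psi>] U _ x])
      (simp add: y int_vec_common_monom)
  also have "\<dots> = (\<Sum>k\<in>UNIV. of_int (w $ k) * generic_part $ k) * pd_monom common_monom \<psi> x"
    by (simp add: cvec_def distrib_left sum.distrib)
  also have "(\<Sum>k\<in>UNIV. of_int (w $ k) * generic_part $ k) = 0"
    unfolding sum_row_dependence[OF w, symmetric] by (simp add: generic_part_def)
  finally show ?thesis by simp
qed

definition coeff_at :: "'n \<Rightarrow> int^'n \<Rightarrow> complex" where
  "coeff_at j l = phi_coeff_ext (phi_exponent j) (shift j - base + l)"

lemma phi_exponent_add: "phi_exponent j + cvec (shift j - base + l) = generic_part + cvec l"
  by (simp add: phi_exponent_def)

lemma coeff_at_minus_axis: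
  assumes j: "j \<in> J" and i: "i \<in> J" and l: "l \<in> int_kernel A" and "l \<noteq> 0 \<or> i \<noteq> j"
  shows "coeff_at j (l - axis i 1) = of_int (l $ i) * coeff_at j l"
proof -
  have val: "phi_exponent j $ i + of_int ((shift j - base + l) $ i) = of_int (l $ i)"
    using arg_cong[OF phi_exponent_add[of j l], of "\<lambda>u. u $ i"] i by (simp add: cvec_def generic_part_def)
  have "phi_coeff_ext (phi_exponent j) (shift j - base + l - axis i 1)
      = of_int (l $ i) * phi_coeff_ext (phi_exponent j) (shift j - base + l)"
    unfolding val[symmetric]
  proof (rule phi_coeff_ext_minus_axis)
    assume "phi_exponent j $ i + of_int ((shift j - base + l) $ i) = 0" "i \<in> nsupp (phi_exponent j)"
    then have li: "l $ i = 0" and ij: "i = j"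
      unfolding val nsupp_phi_exponent[OF j] by simp_all
    then have "l \<noteq> 0" using assms(4) by blast
    then obtain k where k: "k \<in> J" "l $ k < 0"
      using int_kernel_nonneg_imp_zero[OF l] by (meson not_less)
    with li have "k \<noteq> i" by auto
    with k have "k \<in> nsupp (generic_part + cvec (l - axis i 1))"
      unfolding nsupp_generic_part_add by (simp add: axis_def)
    then have "k \<in> nsupp (phi_exponent j + cvec (shift j - base + l - axis i 1))"
      unfolding add_diff_eq[symmetric] phi_exponent_add .
    then show "nsupp (phi_exponent j + cvec (shift j - base + l - axis i 1)) \<noteq> nsupp (phi_exponent j)"
      unfolding nsupp_phi_exponent[OF j] using \<open>k \<noteq> i\<close> ij by blast
  qed
  then show ?thesis
    by (simp only: coeff_at_def add_diff_eq)
qed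

lemma coeff_at_minus_axis_nonzero: "j \<in> J \<Longrightarrow> coeff_at j (- axis j 1) \<noteq> 0"
  unfolding coeff_at_def phi_coeff_ext_eq_0_iff phi_exponent_add nsupp_phi_exponent nsupp_generic_part_add
  by (auto simp: axis_def)

lemma sum_row_dependence_coeff_at:
  assumes w: "w \<in> row_dependences" and j: "j \<in> J" and l: "l \<in> int_kernel A"
  shows "(\<Sum>i\<in>J. of_int (w $ i) * coeff_at j (l - axis i 1))
    = (if l = 0 then of_int (w $ j) * coeff_at j (- axis j 1) else 0)"
proof (cases "l = 0")
  case True
  have "(\<Sum>i\<in>J. of_int (w $ i) * coeff_at j (0 - axis i 1))
      = (\<Sum>i\<in>{j}. of_int (w $ i) * coeff_at j (0 - axis i 1))"
    using j coeff_at_minus_axis[OF j _ int_kernel_zero] by (intro sum.mono_neutral_right) auto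
  with True show ?thesis by simp
next
  case False
  have "(\<Sum>i\<in>J. of_int (w $ i) * coeff_at j (l - axis i 1))
      = (\<Sum>i\<in>J. of_int (w $ i) * of_int (l $ i)) * coeff_at j l"
    using coeff_at_minus_axis[OF j _ l] False by (simp add: sum_distrib_right mult.assoc)
  also have "(\<Sum>i\<in>J. of_int (w $ i) * of_int (l $ i)) = (of_int (\<Sum>k\<in>UNIV. w $ k * l $ k) :: complex)"
    by (simp add: sum_row_dependence[OF w])
  finally show ?thesis
    using row_dependence_orthogonal[OF w l] False by simp
qed

lemma coordinate_pd_monom_has_sum:
  assumes i: "i \<in> J" and L: "log_branch L U" and x: "x \<in> U"
    and sum: "((\<lambda>l. phi_term L (phi_exponent j) (l - int_vec (monom_of i)) x)
      has_sum pd_monom (monom_of i) f x) (int_kernel A)"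
  shows "((\<lambda>l. coeff_at j (l - axis i 1) * monomial L (generic_part + cvec l) x)
    has_sum x $ i * pd_monom (monom_of i) f x) (int_kernel A)"
proof -
  have bij: "bij_betw (\<lambda>l. l + (shift j - shift i)) (int_kernel A) (int_kernel A)"
    by (rule bij_betw_byWitness[where f' = "\<lambda>l. l - (shift j - shift i)"])
       (auto intro!: int_kernel_add int_kernel_diff shift_in_int_kernel)
  have reindexed: "l + (shift j - shift i) - int_vec (monom_of i) = shift j - base + (l - axis i 1)" for l
    unfolding int_vec_monom_of[OF i] by (simp add: algebra_simps)
  have "((\<lambda>l. coeff_at j (l - axis i 1) * monomial L (generic_part + cvec (l - axis i 1)) x)
      has_sum pd_monom (monom_of i) f x) (int_kernel A)"
    using iffD2[OF has_sum_reindex_bij_betw[OF bij] sum]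
    by (simp only: phi_term_def reindexed phi_exponent_add coeff_at_def)
  then have "((\<lambda>l. x $ i * (coeff_at j (l - axis i 1) * monomial L (generic_part + cvec (l - axis i 1)) x))
      has_sum x $ i * pd_monom (monom_of i) f x) (int_kernel A)"
    by (rule has_sum_cmult_right)
  moreover have "x $ i * (c * monomial L (generic_part + cvec (l - axis i 1)) x)
      = c * monomial L (generic_part + cvec l) x" for c l
    using monomial_add_axis[OF L x, of "generic_part + cvec (l - axis i 1)" i]
    by (simp add: add_diff_eq mult.left_commute)
  ultimately show ?thesis by (simp only:)
qed

lemma annihilator_phi_sum:
  assumes w: "w \<in> row_dependences" and j: "j \<in> J" and \<phi>: "phi_sum A (phi_exponent j) q f"
  obtains \<epsilon> L where "\<epsilon> > 0" "log_branch L (ball q \<epsilon>)"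
    "\<forall>\<^sub>F x in nhds q. annihilator w f x = of_int (w $ j) * coeff_at j (- axis j 1) * monomial L generic_part x"
proof -
  obtain \<epsilon> L where \<epsilon>: "\<epsilon> > 0" and L: "log_branch L (ball q \<epsilon>)"
    and sums: "\<And>m. \<forall>\<^sub>F x in nhds q.
      ((\<lambda>l. phi_term L (phi_exponent j) (l - int_vec m) x)
        has_sum pd_monom m f x) (int_kernel A)"
    by (rule phi_sum_pd_monom_has_sum[OF min_nsupp_phi_exponent[OF j] \<phi>]) (rule that)
  have "\<forall>\<^sub>F x in nhds q. \<forall>i\<in>J. ((\<lambda>l. phi_term L (phi_exponent j) (l - int_vec (monom_of i)) x)
        has_sum pd_monom (monom_of i) f x) (int_kernel A)"
    using sums by (intro eventually_ball_finite) auto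
  moreover have "\<forall>\<^sub>F x in nhds q. x \<in> ball q \<epsilon>"
    using \<epsilon> by (intro eventually_nhds_in_open) auto
  ultimately have "\<forall>\<^sub>F x in nhds q.
      annihilator w f x = of_int (w $ j) * coeff_at j (- axis j 1) * monomial L generic_part x"
  proof eventually_elim
    case (elim x)
    define t where "t = of_int (w $ j) * coeff_at j (- axis j 1) * monomial L generic_part x"
    have "((\<lambda>l. \<Sum>i\<in>J. of_int (w $ i) * (coeff_at j (l - axis i 1) * monomial L (generic_part + cvec l) x))
        has_sum annihilator w f x) (int_kernel A)"
      unfolding annihilator_def using elim
      by (intro has_sum_sum has_sum_cmult_right coordinate_pd_monom_has_sum[OF _ L]) auto
    moreover have "(\<Sum>i\<in>J. of_int (w $ i) * (coeff_at j (l - axis i 1) * monomial L (generic_part + cvec l) x))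
        = (if l = 0 then t else 0)" if "l \<in> int_kernel A" for l
      using sum_row_dependence_coeff_at[OF w j that] by (simp add: t_def flip: sum_distrib_right mult.assoc)
    ultimately have "((\<lambda>l. if l = 0 then t else 0) has_sum annihilator w f x) (int_kernel A)"
      by (simp cong: has_sum_cong)
    moreover have "((\<lambda>l. if l = 0 then t else 0) has_sum t) (int_kernel A)"
      by (intro has_sum_finite_neutralI[where B = "{0}"]) (auto simp: int_kernel_zero)
    ultimately show ?case unfolding t_def by (rule has_sum_unique)
  qed
  then show thesis using that \<epsilon> L by blast
qed

lemma annihilator_is_phi_eq_0_iff:
  assumes w: "w \<in> row_dependences" and j: "j \<in> J" and \<phi>: "is_phi A (phi_exponent j) p \<phi>"
    and U: "open U" "p \<in> U" and hol: "\<phi> sep_holomorphic_on U" and L: "log_branch L U"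
  shows "annihilator w \<phi> p = 0 \<longleftrightarrow> w $ j = 0"
proof -
  obtain L' c where P: "\<forall>\<^sub>F x in nhds p. annihilator w \<phi> x = c * monomial L' generic_part x"
    and c: "c = 0 \<longleftrightarrow> w $ j = 0"
  proof (cases "phi_converges A (phi_exponent j) p")
    case True
    then have "phi_sum A (phi_exponent j) p \<phi>" using \<phi> by (simp add: is_phi_def)
    then show thesis
      using that coeff_at_minus_axis_nonzero[OF j] by (elim annihilator_phi_sum[OF w j]) force
  next
    case False
    then obtain q g where g: "phi_sum A (phi_exponent j) q g" and cont: "continues_to g q \<phi> p"
      using \<phi> by (auto simp: is_phi_def)
    obtain \<epsilon> L' where "\<epsilon> > 0" "log_branch L' (ball q \<epsilon>)" "\<forall>\<^sub>F x in nhds q.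
        annihilator w g x = of_int (w $ j) * coeff_at j (- axis j 1) * monomial L' generic_part x"
      by (rule annihilator_phi_sum[OF w j g])
    then obtain c where "\<forall>\<^sub>F x in nhds p. annihilator w \<phi> x = c * monomial L generic_part x"
      "c = 0 \<longleftrightarrow> of_int (w $ j) * coeff_at j (- axis j 1) = 0"
      by (elim weyl_monomial_continues_to[OF weyl_annihilator cont _ open_ball _ L U hol]) simp
    then show thesis
      using that coeff_at_minus_axis_nonzero[OF j] by simp
  qed
  have "annihilator w \<phi> p = c * monomial L' generic_part p"
    using P by (rule eventually_nhds_x_imp_x)
  then show ?thesis by (simp add: c monomial_nonzero)
qed

definition minor :: "'n \<Rightarrow> 'n \<Rightarrow> int" where
  "minor i k = B $ i $ 1 * B $ k $ 2 - B $ i $ 2 * B $ k $ 1"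

text \<open>Cramer's rule for the linear dependence between the rows \<open>j\<close>, \<open>j3\<close>, \<open>j4\<close> of \<open>B\<close>.\<close>

definition cramer_dependence :: "'n \<Rightarrow> int^'n" where
  "cramer_dependence j = (\<chi> k. if k = j then minor j3 j4 else if k = j3 then minor j4 j
     else if k = j4 then minor j j3 else 0)"

lemma minor_pos: "minor j3 j4 > 0"
proof -
  have "B $ j3 $ 1 * B $ j4 $ 2 > 0" "B $ j3 $ 2 * B $ j4 $ 1 < 0"
    using row3 row4 by (auto intro: mult_neg_neg mult_neg_pos)
  then show ?thesis by (simp add: minor_def)
qed

lemma cramer_dependence_in_row_dependences:
  assumes j: "j \<in> {j1, j2}"
  shows "cramer_dependence j \<in> row_dependences"
proof -
  have distinct_j: "j \<noteq> j3" "j \<noteq> j4" "j3 \<noteq> j" "j4 \<noteq> j" using j distinct_indices by auto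
  have "(cramer_dependence j v* B) $ c = 0" for c
  proof -
    have "(cramer_dependence j v* B) $ c = (\<Sum>k\<in>{j, j3, j4}. cramer_dependence j $ k * B $ k $ c)"
      unfolding vector_matrix_mult_def vec_lambda_beta
      by (rule sum.mono_neutral_right) (auto simp: cramer_dependence_def)
    also have "\<dots> = minor j3 j4 * B $ j $ c + minor j4 j * B $ j3 $ c + minor j j3 * B $ j4 $ c"
      using distinct_j distinct_indices by (simp add: cramer_dependence_def)
    also have "\<dots> = 0"
      using exhaust_2[of c] by (auto simp: minor_def algebra_simps)
    finally show ?thesis .
  qed
  then show ?thesis
    using j by (auto simp: row_dependences_def cramer_dependence_def J_def vec_eq_iff)
qed

lemma phi_independent_modulo_pd_image:
  assumes U: "open U" "p \<in> U" and L: "log_branch L V" "open V" "p \<in> V"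
    and \<phi>: "\<And>j. j \<in> {j1, j2} \<Longrightarrow> is_phi A (phi_exponent j) p (\<phi> j) \<and> \<phi> j sep_holomorphic_on U"
  shows "cfun_modulo.independent_family (pd_map U j3 `
    solutions U A (map_matrix of_int A *v (generic_part + cvec (base + axis j3 1)))) \<phi> {j1, j2}"
    (is "cfun_modulo.independent_family ?Img \<phi> _")
proof (rule cfun_modulo.independent_familyI_subspaces)
  fix i j assume ij: "i \<in> {j1, j2}" "j \<in> {j1, j2}"
  have L': "log_branch L (U \<inter> V)"
    by (rule log_branch_subset[OF L(1)]) blast
  show "cfun.subspace {f. f sep_holomorphic_on U \<and> annihilator (cramer_dependence i) f p = 0}"
    by (rule subspace_weyl_kernel_at[OF weyl_annihilator U])
  show "?Img \<subseteq> {f. f sep_holomorphic_on U \<and> annihilator (cramer_dependence i) f p = 0}"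
    using cramer_dependence_in_row_dependences[OF ij(1)] solutions_imp_sep_holomorphic_on
    by (auto intro!: annihilator_pd_map U sep_holomorphic_on_pd_map)
  have "annihilator (cramer_dependence i) (\<phi> j) p = 0 \<longleftrightarrow> cramer_dependence i $ j = 0"
    using ij \<phi>[OF ij(2)] U L L'
    by (intro annihilator_is_phi_eq_0_iff[where U = "U \<inter> V"] cramer_dependence_in_row_dependences)
      (auto simp: J_def intro: sep_holomorphic_on_subset)
  also have "\<dots> \<longleftrightarrow> j \<noteq> i"
    using ij minor_pos distinct_indices by (auto simp: cramer_dependence_def)
  finally show "\<phi> j \<in> {f. f sep_holomorphic_on U \<and> annihilator (cramer_dependence i) f p = 0} \<longleftrightarrow> j \<noteq> i"
    using \<phi>[OF ij(2)] by simp
qed simp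

end


theorem theorem4p6:
  fixes A :: "int^'n::finite^'d::finite" and B :: "int^2^'n"
    and i\<^sub>0 :: 'd and j1 j2 j3 j4 :: 'n
    and \<alpha> v p :: "complex^'n" and \<beta> :: "complex^'d" and r :: real
    and \<phi>1 \<phi>2 \<phi>3 \<phi>4 :: "complex^'n \<Rightarrow> complex"
  assumes rank: "rank (map_matrix real_of_int A) = CARD('d)"
    and codim: "CARD('n) = CARD('d) + 2"
    and ones: "\<And>j. A $ i\<^sub>0 $ j = 1"
    and cols: "\<And>y. \<exists>u. A *v u = y"
    and basis: "bij_betw (\<lambda>z. B *v z) UNIV {u. A *v u = 0}"
    and indices: "distinct [j1, j2, j3, j4]"
    and row1: "B $ j1 $ 1 > 0" "B $ j1 $ 2 > 0"
    and row2: "B $ j2 $ 1 < 0" "B $ j2 $ 2 > 0"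
    and row3: "B $ j3 $ 1 < 0" "B $ j3 $ 2 < 0"
    and row4: "B $ j4 $ 1 > 0" "B $ j4 $ 2 < 0"
    and cone: "(\<forall>a b :: real. a *s row j2 (map_matrix real_of_int B)
                  + b *s row j4 (map_matrix real_of_int B) = 0 \<longrightarrow> a = 0 \<and> b = 0) \<Longrightarrow>
       {z :: real^2. (map_matrix real_of_int B *v z) $ j2 \<ge> 0 \<and> (map_matrix real_of_int B *v z) $ j4 \<ge> 0}
         \<subseteq> {z. z $ 1 \<ge> 0 \<and> z $ 2 \<ge> 0}"
    and irrational: "\<And>i. i \<notin> {j1, j2, j3, j4} \<Longrightarrow> \<alpha> $ i \<notin> \<rat>"
    and generic: "\<And>i. i \<notin> {j1, j2, j3, j4} \<Longrightarrow>
       \<alpha> $ i \<notin> rat_adjoin {\<alpha> $ j | j. j \<notin> {j1, j2, j3, j4} \<and> j \<noteq> i}"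
    and v: "v = cvec (pos_part (column 1 B) + pos_part (column 2 B))
               - axis j1 1 - axis j2 1 - axis j4 1
               + (\<chi> i. if i \<in> {j1, j2, j3, j4} then 0 else \<alpha> $ i)"
    and \<beta>: "\<beta> = map_matrix of_int A *v (v - axis j3 1)"
    and r: "r > 0"
    (* If two opposite rows of B are parallel, then two opposite series have no common domain of
       convergence; they are then related by analytic continuation. *)
    and point: "phi_converges A (v - axis j3 1 - cvec (column 1 B) - cvec (column 2 B)) p \<or>
                phi_converges A (v - axis j3 1) p"
               "phi_converges A (v - axis j3 1 - cvec (column 2 B)) p \<or>
                phi_converges A (v - axis j3 1 - cvec (column 1 B)) p"
    and sol: "{\<phi>1, \<phi>2, \<phi>3, \<phi>4} \<subseteq> solutions (ball p r) A \<beta>"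
    and \<phi>1: "is_phi A (v - axis j3 1 - cvec (column 1 B) - cvec (column 2 B)) p \<phi>1"
    and \<phi>2: "is_phi A (v - axis j3 1 - cvec (column 2 B)) p \<phi>2"
    and \<phi>3: "is_phi A (v - axis j3 1) p \<phi>3"
    and \<phi>4: "is_phi A (v - axis j3 1 - cvec (column 1 B)) p \<phi>4"
  shows "let S = cfun.span {\<phi>1, \<phi>2, \<phi>3, \<phi>4};
             Img = pd_map (ball p r) j3 ` solutions (ball p r) A (map_matrix of_int A *v v)
         in cfun.dim (Img \<inter> S) \<le> 2 \<and>
            dim_mod S Img \<ge> 2 \<and>
            (\<exists>g1 g2. g1 \<in> S \<and> g2 \<in> S \<and> {g1, g2} \<subseteq> solutions (ball p r) A \<beta> \<and>
               (\<forall>a b. cscale a g1 + cscale b g2 \<in> Img \<longrightarrow> a = 0 \<and> b = 0))"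
proof -
  interpret quadrant_rows A B j1 j2 j3 j4 \<alpha>
    by unfold_locales (fact cols basis indices row1 row2 row3 row4 irrational)+
  have v_eq: "v = generic_part + cvec (base + axis j3 1)"
    using distinct_indices by (simp add: v generic_part_def base_def J_def algebra_simps)
  have exponents: "phi_exponent j1 = v - axis j3 1 - cvec (column 1 B) - cvec (column 2 B)"
    "phi_exponent j2 = v - axis j3 1 - cvec (column 2 B)"
    using distinct_indices by (simp_all add: phi_exponent_def shift_def v_eq algebra_simps)
  define Img where "Img = pd_map (ball p r) j3 ` solutions (ball p r) A (map_matrix of_int A *v v)"
  define \<phi> where "\<phi> j = (if j = j1 then \<phi>1 else \<phi>2)" for j
  obtain L V where L: "log_branch L V" "open V" "p \<in> V"
    using point(1) by (elim disjE phi_converges_imp_log_branch)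
  have indep: "cfun_modulo.independent_family Img \<phi> {j1, j2}"
    unfolding Img_def v_eq using r \<phi>1 \<phi>2 sol distinct_indices solutions_imp_sep_holomorphic_on
    by (intro phi_independent_modulo_pd_image[OF _ _ L]) (auto simp: \<phi>_def exponents)
  have "cfun.dim (Img \<inter> cfun.span {\<phi>1, \<phi>2, \<phi>3, \<phi>4}) \<le> 2"
    and "dim_mod (cfun.span {\<phi>1, \<phi>2, \<phi>3, \<phi>4}) Img \<ge> 2"
    using cfun_modulo.dim_Int_span_add_card_le[OF indep, of "{\<phi>1, \<phi>2, \<phi>3, \<phi>4}"]
      card_le_dim_mod[OF indep, of "{\<phi>1, \<phi>2, \<phi>3, \<phi>4}"] distinct_indices
    by (auto simp: \<phi>_def cfun.span_base card_insert_if split: if_splits)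
  moreover have "\<forall>a b. cscale a \<phi>1 + cscale b \<phi>2 \<in> Img \<longrightarrow> a = 0 \<and> b = 0"
    using cfun_modulo.independent_family_pairD[OF indep] distinct_indices by (simp add: \<phi>_def)
  ultimately show ?thesis
    unfolding Let_def Img_def[symmetric] using sol by (blast intro: cfun.span_base)
qed

end
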